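(* Let $n\ge 2$ and $j\in\{1,\ldots,n-1\}$, and let $\mathcal{K}$ be a finite vertex-describable abstract $n$-polytope which is $j$-face hereditary. Then $\mathcal{K}$ is (isomorphic to) the vertex-figure of a vertex-transitive finite abstract $(n+1)$-polytope which is $(j+1)$-face hereditary.
   Context: An abstract $m$-polytope is a partially ordered set with a strictly monotone rank function onto $\{-1,\ldots,m\}$, with least face $F_{-1}$ and greatest face $F_m$, all flags (maximal chains) of size $m+2$, strongly flag-connected, satisfying the diamond condition. Its automorphism group is $\Gamma(\cdot)$. The vertex-figure at a vertex $u$ is the section $F_m/u=\{G: u\le G\le F_m\}$. A polytope is vertex-describable if each face is uniquely determined by its set of vertices. A polytope $\mathcal{P}$ of rank $m$ is $j$-face hereditary if for every $j$-face $F$, every automorphism of the section $F/F_{-1}$ extends to an automorphism of $\mathcal{P}$ (which then fixes $F$). Vertex-transitive means the automorphism group is transitive on vertices. *)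

theory Defs
  imports Main
begin

text \<open>
  A poset is represented by its reflexive order relation \<^term>\<open>r\<close>; its underlying set is
  \<^term>\<open>Field r\<close>. Poset isomorphisms are given by the library predicate \<^const>\<open>iso\<close>, which is
  introduced there for well-orders but for arbitrary relations says that \<^term>\<open>f\<close> is a
  bijection of the fields preserving the relation in both directions (lemma iso_iff2).
  Isomorphisms are total functions whose values outside \<^term>\<open>Field r\<close> are irrelevant.
\<close>

definition is_least :: "'a rel \<Rightarrow> 'a \<Rightarrow> bool" where
  "is_least r x \<longleftrightarrow> x \<in> Field r \<and> (\<forall>y\<in>Field r. (x, y) \<in> r)"

definition is_greatest :: "'a rel \<Rightarrow> 'a \<Rightarrow> bool" where
  "is_greatest r x \<longleftrightarrow> x \<in> Field r \<and> (\<forall>y\<in>Field r. (y, x) \<in> r)"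

definition least_face :: "'a rel \<Rightarrow> 'a" where
  "least_face r = (THE x. is_least r x)"

definition greatest_face :: "'a rel \<Rightarrow> 'a" where
  "greatest_face r = (THE x. is_greatest r x)"

definition flags :: "'a rel \<Rightarrow> 'a set set" where
  "flags r = {C \<in> Chains r. \<forall>D\<in>Chains r. C \<subseteq> D \<longrightarrow> D = C}"

definition adjacent :: "'a set \<Rightarrow> 'a set \<Rightarrow> bool" where
  "adjacent A B \<longleftrightarrow> card (A - B) = 1 \<and> card (B - A) = 1"

definition strongly_flag_connected :: "'a rel \<Rightarrow> bool" where
  "strongly_flag_connected r \<longleftrightarrow>
     (\<forall>A\<in>flags r. \<forall>B\<in>flags r.
        (A, B) \<in> {(C, D). C \<in> flags r \<and> D \<in> flags r \<and> A \<inter> B \<subseteq> C \<and> A \<inter> B \<subseteq> D \<and> adjacent C D}\<^sup>*)"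

locale abstract_polytope =
  fixes m :: nat and r :: "'a rel" and rk :: "'a \<Rightarrow> int"
  assumes partial_order: "Partial_order r"
    and least: "\<exists>x. is_least r x"
    and greatest: "\<exists>x. is_greatest r x"
    and rank_strict_mono: "\<And>x y. (x, y) \<in> r \<Longrightarrow> x \<noteq> y \<Longrightarrow> rk x < rk y"
    and rank_onto: "rk ` Field r = {-1..int m}"
    and flag_card: "\<And>C. C \<in> flags r \<Longrightarrow> card C = m + 2"
    and flag_connected: "strongly_flag_connected r"
    and diamond: "\<And>F G. (F, G) \<in> r \<Longrightarrow> rk G - rk F = 2 \<Longrightarrow>
        card {H. (F, H) \<in> r \<and> H \<noteq> F \<and> (H, G) \<in> r \<and> H \<noteq> G} = 2"

definition faces :: "int \<Rightarrow> 'a rel \<Rightarrow> ('a \<Rightarrow> int) \<Rightarrow> 'a set" where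
  "faces i r rk = {F \<in> Field r. rk F = i}"

definition face_vertices :: "'a rel \<Rightarrow> ('a \<Rightarrow> int) \<Rightarrow> 'a \<Rightarrow> 'a set" where
  "face_vertices r rk F = {v \<in> faces 0 r rk. (v, F) \<in> r}"

text \<open>\<open>face_section r F G\<close> is the section usually written \<open>G/F\<close>.\<close>

definition face_section :: "'a rel \<Rightarrow> 'a \<Rightarrow> 'a \<Rightarrow> 'a rel" where
  "face_section r F G = Restr r {H. (F, H) \<in> r \<and> (H, G) \<in> r}"

definition vertex_figure :: "'a rel \<Rightarrow> 'a \<Rightarrow> 'a rel" where
  "vertex_figure r u = face_section r u (greatest_face r)"

definition vertex_describable :: "'a rel \<Rightarrow> ('a \<Rightarrow> int) \<Rightarrow> bool" where
  "vertex_describable r rk \<longleftrightarrow> inj_on (face_vertices r rk) (Field r)"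

definition automorphism :: "'a rel \<Rightarrow> ('a \<Rightarrow> 'a) \<Rightarrow> bool" where
  "automorphism r f \<longleftrightarrow> iso r r f"

definition vertex_transitive :: "'a rel \<Rightarrow> ('a \<Rightarrow> int) \<Rightarrow> bool" where
  "vertex_transitive r rk \<longleftrightarrow>
     (\<forall>u\<in>faces 0 r rk. \<forall>v\<in>faces 0 r rk. \<exists>f. automorphism r f \<and> f u = v)"

definition face_hereditary :: "nat \<Rightarrow> 'a rel \<Rightarrow> ('a \<Rightarrow> int) \<Rightarrow> bool" where
  "face_hereditary j r rk \<longleftrightarrow>
     (\<forall>F\<in>faces (int j) r rk. \<forall>g. automorphism (face_section r (least_face r) F) g \<longrightarrow>
        (\<exists>f. automorphism r f \<and> (\<forall>x\<in>Field (face_section r (least_face r) F). f x = g x)))"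

end

theory Submission
  imports Defs
begin

text \<open>The witness is Danzer's power complex \<open>2\<^sup>K\<close>, whose vertices are the \<open>0/1\<close>-vectors indexed by the
  vertices of \<open>K\<close> and whose vertex-figures are copies of \<open>K\<close>. Translations make it vertex-transitive.
  An automorphism of a \<open>(j+1)\<close>-face \<open>2\<^sup>F\<close> becomes, after a translation, one that fixes a vertex; it then
  acts on the vertex-figure \<open>F/F\<^bsub>-1\<^esub>\<close> of \<open>2\<^sup>F\<close>, this action extends to \<open>K\<close> by heredity, and an
  automorphism of \<open>K\<close> acts on \<open>2\<^sup>K\<close> by permuting coordinates. The extension is correct
  because an automorphism of a section which fixes every face of a flag is the identity.\<close>

section \<open>Automorphisms and flags\<close>

text \<open>Heredity of \<open>K\<close> controls only the faces above one vertex of the cube, so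
  the extension built from it agrees with the given map only there. Together with the least face
  these faces contain the lower part of a flag, from which rigidity spreads the agreement to the
  whole section. Rigidity is therefore proved for order-preserving injective maps on the faces below
  a given one: the map it is applied to, the given automorphism followed by the inverse of the
  extension, is not known in advance to preserve the section.

  The change from \<open>j\<close> to \<open>j + 1\<close> comes from the new least face: a face of
  \<open>K\<close> of rank i yields cubes of rank i + 1, its least face yielding the vertices.

  The cubes have a type built from that of \<open>K\<close>, whereas the conclusion asks for a
  polytope on \<open>nat\<close>, because an existential quantifier cannot range over types. Hence a
  finite poset has to be copied into \<open>nat\<close> and every notion carried along.\<close>

lemma automorphism_iff:
  "automorphism r f \<longleftrightarrow> bij_betw f (Field r) (Field r) \<and>
     (\<forall>x\<in>Field r. \<forall>y\<in>Field r. (x, y) \<in> r \<longleftrightarrow> (f x, f y) \<in> r)"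
  unfolding automorphism_def by (rule iso_iff2)

text \<open>Translations, lifted maps and conjugates all come with an explicit inverse; from two
  mutually inverse monotone maps, bijectivity and reflection of the order follow.\<close>

lemma automorphismI:
  assumes "\<And>x y. (x, y) \<in> r \<Longrightarrow> (f x, f y) \<in> r"
    and "\<And>x y. (x, y) \<in> r \<Longrightarrow> (f' x, f' y) \<in> r"
    and "\<And>x. x \<in> Field r \<Longrightarrow> f' (f x) = x"
    and "\<And>x. x \<in> Field r \<Longrightarrow> f (f' x) = x"
  shows "automorphism r f"
  unfolding automorphism_iff
proof (intro conjI ballI)
  have "f x \<in> Field r" "f' x \<in> Field r" if "x \<in> Field r" for x
    using that assms(1,2) unfolding Field_def by blast+
  then show "bij_betw f (Field r) (Field r)"
    using assms(3,4) by (intro bij_betw_byWitness[where f' = f']) auto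
  show "(x, y) \<in> r \<longleftrightarrow> (f x, f y) \<in> r" if "x \<in> Field r" "y \<in> Field r" for x y
    using assms(1)[of x y] assms(2)[of "f x" "f y"] assms(3)[OF that(1)] assms(3)[OF that(2)] by metis
qed

lemma automorphism_mono: "automorphism r f \<Longrightarrow> (x, y) \<in> r \<Longrightarrow> (f x, f y) \<in> r"
  unfolding automorphism_iff by (meson FieldI1 FieldI2)

lemma automorphism_Field: "automorphism r f \<Longrightarrow> x \<in> Field r \<Longrightarrow> f x \<in> Field r"
  unfolding automorphism_iff by (meson bij_betwE)

lemma automorphism_eq_iff:
  "automorphism r f \<Longrightarrow> x \<in> Field r \<Longrightarrow> y \<in> Field r \<Longrightarrow> f x = f y \<longleftrightarrow> x = y"
  unfolding automorphism_iff bij_betw_def by (meson inj_on_eq_iff)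

lemma automorphism_inverse:
  assumes "automorphism r f"
  obtains f' where "automorphism r f'" "\<And>x. x \<in> Field r \<Longrightarrow> f' (f x) = x"
    "\<And>x. x \<in> Field r \<Longrightarrow> f (f' x) = x"
proof
  let ?f' = "inv_into (Field r) f"
  have bij: "bij_betw f (Field r) (Field r)"
    using assms by (simp add: automorphism_iff)
  show left: "?f' (f x) = x" if "x \<in> Field r" for x
    using bij that by (rule bij_betw_inv_into_left)
  show right: "f (?f' x) = x" if "x \<in> Field r" for x
    using bij that by (rule bij_betw_inv_into_right)
  have bij': "bij_betw ?f' (Field r) (Field r)"
    using bij by (rule bij_betw_inv_into)
  moreover have "(x, y) \<in> r \<longleftrightarrow> (?f' x, ?f' y) \<in> r" if "x \<in> Field r" "y \<in> Field r" for x y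
    using assms right[OF that(1)] right[OF that(2)] bij_betwE[OF bij'] that
    unfolding automorphism_iff by metis
  ultimately show "automorphism r ?f'"
    by (simp add: automorphism_iff)
qed

lemma automorphism_comp:
  "automorphism r f \<Longrightarrow> automorphism r g \<Longrightarrow> automorphism r (f \<circ> g)"
  unfolding automorphism_iff by (auto intro: bij_betw_trans dest: bij_betwE)

lemma Field_face_section:
  assumes "Partial_order r"
  shows "Field (face_section r F G) = {H. (F, H) \<in> r \<and> (H, G) \<in> r}"
  using assms unfolding face_section_def Field_def order_on_defs refl_on_def by auto

lemma face_section_iff:
  "(x, y) \<in> face_section r F G \<longleftrightarrow>
     (x, y) \<in> r \<and> (F, x) \<in> r \<and> (x, G) \<in> r \<and> (F, y) \<in> r \<and> (y, G) \<in> r"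
  unfolding face_section_def by auto

lemma Chains_Field: "C \<in> Chains q \<Longrightarrow> C \<subseteq> Field q"
  unfolding Chains_def by (auto intro: FieldI1)

lemma flags_Field: "C \<in> flags q \<Longrightarrow> C \<subseteq> Field q"
  unfolding flags_def using Chains_Field by blast

section \<open>Finite polytopes: extreme faces, flags and ranks\<close>

locale finite_abstract_polytope = abstract_polytope m r rk
  for m and r :: "'a rel" and rk +
  assumes finite_Field: "finite (Field r)"
begin

lemma refl: "x \<in> Field r \<Longrightarrow> (x, x) \<in> r"
  using partial_order by (simp add: order_on_defs refl_on_def)

lemma trans: "(x, y) \<in> r \<Longrightarrow> (y, z) \<in> r \<Longrightarrow> (x, z) \<in> r"
  using partial_order by (meson order_on_defs transE)

lemma antisym: "(x, y) \<in> r \<Longrightarrow> (y, x) \<in> r \<Longrightarrow> x = y"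
  using partial_order by (meson order_on_defs antisymD)

abbreviation bot where "bot \<equiv> least_face r"
abbreviation top where "top \<equiv> greatest_face r"

lemma is_least_bot: "is_least r bot"
  unfolding least_face_def by (rule theI') (use least antisym in \<open>auto simp: is_least_def\<close>)

lemma bot_le: "x \<in> Field r \<Longrightarrow> (bot, x) \<in> r"
  using is_least_bot by (simp add: is_least_def)

lemma bot_in: "bot \<in> Field r"
  using is_least_bot by (simp add: is_least_def)

lemma is_greatest_top: "is_greatest r top"
  unfolding greatest_face_def by (rule theI') (use greatest antisym in \<open>auto simp: is_greatest_def\<close>)

lemma le_top: "x \<in> Field r \<Longrightarrow> (x, top) \<in> r"
  using is_greatest_top by (simp add: is_greatest_def)

lemma top_in: "top \<in> Field r"
  using is_greatest_top by (simp add: is_greatest_def)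

lemma rk_mono: "(x, y) \<in> r \<Longrightarrow> rk x \<le> rk y"
  using rank_strict_mono by (cases "x = y") force+

lemma rk_range: "x \<in> Field r \<Longrightarrow> -1 \<le> rk x \<and> rk x \<le> int m"
  using rank_onto by auto

lemma rk_bot: "rk bot = -1"
proof -
  have "-1 \<in> rk ` Field r"
    using rank_onto by simp
  then show ?thesis
    using rk_mono bot_le rk_range bot_in by force
qed

lemma rk_eq_minus_one_iff: "x \<in> Field r \<Longrightarrow> rk x = -1 \<longleftrightarrow> x = bot"
  using rank_strict_mono[OF bot_le] rk_bot by force

lemma le_bot_iff: "(x, bot) \<in> r \<longleftrightarrow> x = bot"
  using antisym bot_le bot_in refl by (metis FieldI1)

text \<open>Only finitely many chains contain \<open>C\<close>, so one that is maximal under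
  inclusion exists without Zorn's lemma.\<close>

lemma chain_extends_to_flag:
  assumes "C \<in> Chains r"
  obtains \<Phi> where "\<Phi> \<in> flags r" "C \<subseteq> \<Phi>"
proof -
  let ?X = "{D \<in> Chains r. C \<subseteq> D}"
  have "?X \<subseteq> Pow (Field r)"
    using Chains_Field by auto
  then have "finite ?X"
    using finite_Field finite_subset by blast
  moreover have "?X \<noteq> {}"
    using assms by auto
  ultimately obtain \<Phi> where "\<Phi> \<in> ?X" "\<forall>D\<in>?X. \<Phi> \<subseteq> D \<longrightarrow> \<Phi> = D"
    using finite_has_maximal[of ?X] by blast
  then show ?thesis
    by (intro that[of \<Phi>]) (auto simp: flags_def)
qed

lemma flag_comparable: "\<Phi> \<in> flags r \<Longrightarrow> x \<in> \<Phi> \<Longrightarrow> y \<in> \<Phi> \<Longrightarrow> (x, y) \<in> r \<or> (y, x) \<in> r"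
  unfolding flags_def Chains_def by auto

lemma flag_maximal:
  assumes "\<Phi> \<in> flags r" "x \<in> Field r" "\<And>y. y \<in> \<Phi> \<Longrightarrow> (x, y) \<in> r \<or> (y, x) \<in> r"
  shows "x \<in> \<Phi>"
proof -
  have "insert x \<Phi> \<in> Chains r"
    using assms refl unfolding flags_def Chains_def by auto
  then show ?thesis
    using assms(1) unfolding flags_def by blast
qed

lemma bot_in_flag: "\<Phi> \<in> flags r \<Longrightarrow> bot \<in> \<Phi>"
  using flag_maximal bot_in bot_le flags_Field by blast

lemma flag_inj_rk: "\<Phi> \<in> flags r \<Longrightarrow> inj_on rk \<Phi>"
  by (rule inj_onI) (metis flag_comparable rank_strict_mono less_irrefl)

text \<open>The \<open>m + 2\<close> faces of a flag have distinct ranks among the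
  \<open>m + 2\<close> integers from -1 to \<open>m\<close>, so counting forces every rank to
  occur.\<close>

lemma flag_rk_image:
  assumes "\<Phi> \<in> flags r"
  shows "rk ` \<Phi> = {-1..int m}"
proof (rule card_subset_eq)
  show "rk ` \<Phi> \<subseteq> {-1..int m}"
    using flags_Field[OF assms] rank_onto by auto
  show "card (rk ` \<Phi>) = card {-1..int m}"
    using card_image[OF flag_inj_rk[OF assms]] flag_card[OF assms] by simp
qed simp

lemma flag_le: "\<Phi> \<in> flags r \<Longrightarrow> x \<in> \<Phi> \<Longrightarrow> y \<in> \<Phi> \<Longrightarrow> rk x \<le> rk y \<Longrightarrow> (x, y) \<in> r"
  by (metis flag_comparable rank_strict_mono leD)

lemma flag_obtain_rank:
  assumes "\<Phi> \<in> flags r" "-1 \<le> i" "i \<le> int m"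
  obtains x where "x \<in> \<Phi>" "rk x = i"
  using assms flag_rk_image[OF assms(1)] by (metis atLeastAtMost_iff imageE)

lemma flag_through:
  assumes "x \<in> Field r"
  obtains \<Phi> where "\<Phi> \<in> flags r" "x \<in> \<Phi>"
proof -
  have "{x} \<in> Chains r"
    using refl[OF assms] by (simp add: Chains_def)
  then show ?thesis
    using chain_extends_to_flag that by blast
qed

lemma vertex_below:
  assumes "x \<in> Field r" "x \<noteq> bot"
  obtains v where "v \<in> faces 0 r rk" "(v, x) \<in> r"
proof -
  obtain \<Phi> where \<Phi>: "\<Phi> \<in> flags r" "x \<in> \<Phi>"
    using flag_through assms(1) .
  have "rk x \<ge> 0"
    using rk_range[OF assms(1)] rk_eq_minus_one_iff[OF assms(1)] assms(2) by linarith
  then show ?thesis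
    using flag_obtain_rank[OF \<Phi>(1), of 0] flag_le[OF \<Phi>(1) _ \<Phi>(2)] flags_Field[OF \<Phi>(1)]
      rk_range[OF assms(1)] that[unfolded faces_def]
    by (smt (verit) mem_Collect_eq of_nat_0 subsetD)
qed

text \<open>Going from a flag to an adjacent one, the diamond condition leaves no choice for the image
  of the new face.\<close>

lemma rigidity:
  assumes G: "G \<in> Field r"
    and mono: "\<And>x y. (x, y) \<in> r \<Longrightarrow> (y, G) \<in> r \<Longrightarrow> (h x, h y) \<in> r"
    and inj: "inj_on h {x. (x, G) \<in> r}"
    and \<Phi>: "\<Phi> \<in> flags r" "G \<in> \<Phi>"
    and fix_\<Phi>: "\<And>x. x \<in> \<Phi> \<Longrightarrow> (x, G) \<in> r \<Longrightarrow> h x = x"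
    and y: "(y, G) \<in> r"
  shows "h y = y"
proof -
  have "insert y {x \<in> \<Phi>. (G, x) \<in> r} \<in> Chains r"
    using flag_comparable[OF \<Phi>(1)] y trans refl FieldI1[OF y] unfolding Chains_def by auto
  then obtain \<Psi> where \<Psi>: "\<Psi> \<in> flags r" "insert y {x \<in> \<Phi>. (G, x) \<in> r} \<subseteq> \<Psi>"
    by (rule chain_extends_to_flag)
  let ?R = "{(C, D). C \<in> flags r \<and> D \<in> flags r \<and> \<Phi> \<inter> \<Psi> \<subseteq> C \<and> \<Phi> \<inter> \<Psi> \<subseteq> D \<and> adjacent C D}"
  have "(\<Phi>, \<Psi>) \<in> ?R\<^sup>*"
    using flag_connected \<Phi>(1) \<Psi>(1) unfolding strongly_flag_connected_def by blast
  then have "\<forall>x\<in>\<Psi>. (x, G) \<in> r \<longrightarrow> h x = x"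
  proof (induction rule: rtrancl_induct)
    case base
    then show ?case using fix_\<Phi> by blast
  next
    case (step C D)
    have C: "C \<in> flags r" and D: "D \<in> flags r" and "adjacent C D"
      using step.hyps by auto
    \<comment> \<open>Common faces are never dropped, so \<open>G\<close> lies in every flag of the
      path. A face newly entering below \<open>G\<close> is thus strictly below \<open>G\<close>,
      and its upper neighbour in the flag is still below \<open>G\<close>.\<close>
    have "G \<in> \<Phi> \<inter> \<Psi>"
      using \<Phi>(2) \<Psi>(2) refl[OF G] by auto
    then have GC: "G \<in> C" and GD: "G \<in> D"
      using step.hyps by auto
    obtain a b where a: "C - D = {a}" and b: "D - C = {b}"
      using \<open>adjacent C D\<close> unfolding adjacent_def by (meson card_1_singletonE)
    have "h b = b" if bG: "(b, G) \<in> r"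
    proof -
      have bD: "b \<in> D" "b \<notin> C" and aC: "a \<in> C" "a \<notin> D"
        using a b by auto
      have "b \<in> Field r"
        using bD flags_Field[OF D] by auto
      \<comment> \<open>Each flag meets every rank exactly once, so the face \<open>a\<close> that
        leaves has the rank of the face \<open>b\<close> that enters.\<close>
      obtain a' where a': "a' \<in> C" "rk a' = rk b"
        using flag_obtain_rank[OF C] rk_range[OF \<open>b \<in> Field r\<close>] by metis
      then have "a' \<notin> D"
        using flag_inj_rk[OF D] bD unfolding inj_on_def by metis
      then have "a' = a"
        using a' a by blast
      then have rk_ab: "rk a = rk b"
        using a' by simp
      have "b \<noteq> bot"
        using bot_in_flag[OF C] bD by auto
      then have "rk b \<ge> 0"
        using rk_range[OF \<open>b \<in> Field r\<close>] rk_eq_minus_one_iff[OF \<open>b \<in> Field r\<close>] by linarith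
      then obtain c where c: "c \<in> D" "rk c = rk b - 1"
        using flag_obtain_rank[OF D, of "rk b - 1"] rk_range[OF \<open>b \<in> Field r\<close>] by auto
      have lt: "rk b < rk G"
        using bG bD GC rank_strict_mono by metis
      then obtain d where d: "d \<in> D" "rk d = rk b + 1"
        using flag_obtain_rank[OF D, of "rk b + 1"] rk_range[OF G] \<open>rk b \<ge> 0\<close> by auto
      have "c \<noteq> b" "d \<noteq> b"
        using c d by auto
      then have cdC: "c \<in> C" "d \<in> C"
        using b c d by auto
      have cb: "(c, b) \<in> r" and bd: "(b, d) \<in> r" and dG: "(d, G) \<in> r"
        using flag_le[OF D] c d bD GD lt by auto
      have ca: "(c, a) \<in> r" and ad: "(a, d) \<in> r"
        using flag_le[OF C] cdC c d aC rk_ab by auto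
      have hc: "h c = c" and hd: "h d = d" and ha: "h a = a"
        using step.IH cdC aC trans[OF cb bG] dG trans[OF ad dG] by auto
      \<comment> \<open>Since \<open>c\<close> and \<open>d\<close> are fixed, monotonicity and
        injectivity place \<open>h b\<close> strictly between them, where only \<open>a\<close> and
        \<open>b\<close> lie. The value \<open>a\<close> is already taken by
        \<open>h a\<close>.\<close>
      let ?M = "{H. (c, H) \<in> r \<and> H \<noteq> c \<and> (H, d) \<in> r \<and> H \<noteq> d}"
      have "card ?M = 2"
        using diamond[of c d] trans[OF cb bd] c d by simp
      have "inj_on h {a, b, c, d}"
        using inj trans[OF ad dG] bG trans[OF cb bG] dG by (elim inj_on_subset) auto
      moreover have "a \<noteq> b" "b \<noteq> c" "b \<noteq> d" "a \<noteq> c" "a \<noteq> d"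
        using aC bD c d rk_ab by auto
      ultimately have ne: "h b \<noteq> a" "h b \<noteq> c" "h b \<noteq> d"
        using ha hc hd by (auto simp: inj_on_def)
      have "{a, b, h b} \<subseteq> ?M"
        using cb bd ca ad ne \<open>b \<noteq> c\<close> \<open>b \<noteq> d\<close> \<open>a \<noteq> c\<close> \<open>a \<noteq> d\<close> mono[OF cb bG] mono[OF bd dG] hc hd by auto
      moreover have "finite ?M"
        by (intro card_ge_0_finite) (simp only: \<open>card ?M = 2\<close>)
      ultimately have "card {a, b, h b} \<le> 2"
        unfolding \<open>card ?M = 2\<close>[symmetric] by (intro card_mono)
      moreover have "card {a, b, h b} = 3" if "h b \<noteq> b"
        using that ne(1) \<open>a \<noteq> b\<close> by (auto simp: card_insert_if)
      ultimately show "h b = b"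
        by force
    qed
    moreover have "x = b \<or> x \<in> C" if "x \<in> D" for x
      using b that by auto
    ultimately show ?case
      using step.IH by metis
  qed
  then show ?thesis
    using \<Psi>(2) y by auto
qed

section \<open>Automorphisms acting on vertices and vertex sets\<close>

lemma automorphism_bot:
  assumes "automorphism r f" shows "f bot = bot"
proof -
  obtain f' where f': "automorphism r f'" "\<And>x. x \<in> Field r \<Longrightarrow> f (f' x) = x"
    using automorphism_inverse[OF assms] by metis
  have "(f bot, f (f' bot)) \<in> r"
    using automorphism_mono[OF assms] bot_le automorphism_Field[OF f'(1) bot_in] by blast
  then show ?thesis
    using f'(2)[OF bot_in] le_bot_iff by simp
qed

text \<open>\<open>automorphism\<close> says nothing about \<open>rk\<close>, so vertices are
  recognised by the order, as the minimal faces other than \<open>bot\<close>: a vertex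
  \<open>w\<close> below \<open>f v\<close> pulls back to a face other than \<open>bot\<close> below
  \<open>v\<close>, which must be \<open>v\<close>.\<close>

lemma automorphism_vertex:
  assumes "automorphism r f" "v \<in> faces 0 r rk"
  shows "f v \<in> faces 0 r rk"
proof -
  obtain f' where f': "automorphism r f'" "\<And>x. x \<in> Field r \<Longrightarrow> f (f' x) = x"
    "\<And>x. x \<in> Field r \<Longrightarrow> f' (f x) = x"
    using automorphism_inverse[OF assms(1)] by metis
  have v: "v \<in> Field r" "rk v = 0"
    using assms(2) by (auto simp: faces_def)
  have "v \<noteq> bot"
    using v rk_bot by auto
  then have "f v \<noteq> bot"
    using automorphism_eq_iff[OF assms(1) v(1) bot_in] automorphism_bot[OF assms(1)] by simp
  then obtain w where w: "w \<in> faces 0 r rk" "(w, f v) \<in> r"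
    using vertex_below automorphism_Field[OF assms(1) v(1)] by metis
  then have "w \<in> Field r" "w \<noteq> bot"
    using rk_bot by (auto simp: faces_def)
  have "(f' w, v) \<in> r"
    using automorphism_mono[OF f'(1) w(2)] f'(3)[OF v(1)] by simp
  moreover have "f' w \<noteq> bot"
    using automorphism_bot[OF assms(1)] f'(2)[OF \<open>w \<in> Field r\<close>] \<open>w \<noteq> bot\<close> by auto
  ultimately have "f' w = v"
    using rank_strict_mono[of "f' w" v] v(2) rk_range[of "f' w"] rk_eq_minus_one_iff[of "f' w"] FieldI1[of "f' w" v r]
    by fastforce
  then show ?thesis
    using f'(2)[OF \<open>w \<in> Field r\<close>] w(1) by simp
qed

lemma face_vertices_automorphism:
  assumes "automorphism r f" "F \<in> Field r"
  shows "face_vertices r rk (f F) = f ` face_vertices r rk F"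
proof
  show "f ` face_vertices r rk F \<subseteq> face_vertices r rk (f F)"
    using automorphism_vertex[OF assms(1)] automorphism_mono[OF assms(1)]
    by (auto simp: face_vertices_def)
  obtain f' where f': "automorphism r f'" "\<And>x. x \<in> Field r \<Longrightarrow> f (f' x) = x"
    "\<And>x. x \<in> Field r \<Longrightarrow> f' (f x) = x"
    using automorphism_inverse[OF assms(1)] by metis
  show "face_vertices r rk (f F) \<subseteq> f ` face_vertices r rk F"
  proof
    fix v assume v: "v \<in> face_vertices r rk (f F)"
    then have "f' v \<in> face_vertices r rk F"
      using automorphism_vertex[OF f'(1)] automorphism_mono[OF f'(1)] f'(3)[OF assms(2)]
      by (force simp: face_vertices_def)
    moreover have "v = f (f' v)"
      using v f'(2) by (simp add: face_vertices_def faces_def)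
    ultimately show "v \<in> f ` face_vertices r rk F" by blast
  qed
qed

lemma face_vertices_mono: "(F, G) \<in> r \<Longrightarrow> face_vertices r rk F \<subseteq> face_vertices r rk G"
  using trans by (auto simp: face_vertices_def)

lemma face_vertices_bot: "face_vertices r rk bot = {}"
  using rk_bot by (auto simp: face_vertices_def faces_def le_bot_iff)

lemma face_vertices_top: "face_vertices r rk top = faces 0 r rk"
  using le_top by (auto simp: face_vertices_def faces_def)

lemma face_vertices_vertex: "v \<in> faces 0 r rk \<Longrightarrow> face_vertices r rk v = {v}"
  using rank_strict_mono refl by (fastforce simp: face_vertices_def faces_def)

end

section \<open>The power complex\<close>

text \<open>\<^term>\<open>None\<close> is the least face, and \<^term>\<open>Some (F, S)\<close> stands for the
  set of all vectors in \<open>{0,1}\<^sup>V\<close> (written as subsets of the vertex set \<open>V\<close> of \<open>K\<close>) which coincide with \<open>S\<close>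
  outside the vertex set of \<open>F\<close>; requiring \<open>S\<close> to be disjoint from the vertex set of \<open>F\<close> makes this
  representation unique.\<close>

definition power_complex :: "'a rel \<Rightarrow> ('a \<Rightarrow> int) \<Rightarrow> ('a \<times> 'a set) option rel" where
  "power_complex r rk =
     {(None, None)} \<union>
     {(None, Some (F, S)) | F S. F \<in> Field r \<and> S \<subseteq> faces 0 r rk - face_vertices r rk F} \<union>
     {(Some (F, S), Some (G, S - face_vertices r rk G)) | F G S.
        (F, G) \<in> r \<and> S \<subseteq> faces 0 r rk - face_vertices r rk F}"

text \<open>As \<open>bot\<close> has rank -1, the shift gives rank 0 to the single vectors
  \<open>Some (bot, S)\<close> and leaves -1 to \<open>None\<close>.\<close>

definition power_rank :: "('a \<Rightarrow> int) \<Rightarrow> ('a \<times> 'a set) option \<Rightarrow> int" where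
  "power_rank rk x = (case x of None \<Rightarrow> -1 | Some (F, S) \<Rightarrow> rk F + 1)"

lemma power_rank_simps [simp]:
  "power_rank rk None = -1" "power_rank rk (Some (F, S)) = rk F + 1"
  by (simp_all add: power_rank_def)

context finite_abstract_polytope
begin

abbreviation V where "V \<equiv> faces 0 r rk"
abbreviation vs where "vs \<equiv> face_vertices r rk"
abbreviation P where "P \<equiv> power_complex r rk"

lemma power_complex_simps [simp]:
  "(None, None) \<in> P"
  "(None, Some (F, S)) \<in> P \<longleftrightarrow> F \<in> Field r \<and> S \<subseteq> V - vs F"
  "(Some (F, S), None) \<notin> P"
  "(Some (F, S), Some (G, T)) \<in> P \<longleftrightarrow> (F, G) \<in> r \<and> S \<subseteq> V - vs F \<and> T = S - vs G"
  by (auto simp: power_complex_def)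

lemma in_power_complex_cases:
  assumes "(x, y) \<in> P"
  obtains "x = None" "y = None"
  | F S where "x = None" "y = Some (F, S)" "F \<in> Field r" "S \<subseteq> V - vs F"
  | F G S where "x = Some (F, S)" "y = Some (G, S - vs G)" "(F, G) \<in> r" "S \<subseteq> V - vs F"
  using assms by (auto simp: power_complex_def)

lemma None_in_Field_power [simp]: "None \<in> Field P"
  by (rule FieldI1[of _ None]) simp

lemma Some_in_Field_power [simp]:
  "Some (F, S) \<in> Field P \<longleftrightarrow> F \<in> Field r \<and> S \<subseteq> V - vs F"
proof
  assume "Some (F, S) \<in> Field P"
  then obtain y where "(Some (F, S), y) \<in> P \<or> (y, Some (F, S)) \<in> P"
    unfolding Field_def by blast
  then show "F \<in> Field r \<and> S \<subseteq> V - vs F"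
    by (elim disjE in_power_complex_cases) (auto intro: FieldI1 FieldI2)
next
  assume "F \<in> Field r \<and> S \<subseteq> V - vs F"
  then show "Some (F, S) \<in> Field P"
    by (intro FieldI2[of None]) simp
qed

lemma None_power_le: "x \<in> Field P \<Longrightarrow> (None, x) \<in> P"
  by (cases x) auto

lemma Field_power_cases:
  assumes "x \<in> Field P"
  obtains "x = None" | F S where "x = Some (F, S)" "F \<in> Field r" "S \<subseteq> V - vs F"
  using assms by (cases x) auto

section \<open>Order, extreme faces and vertices of the power complex\<close>

lemma Partial_order_power: "Partial_order P"
  unfolding order_on_defs
proof (intro conjI)
  show "refl_on (Field P) P"
    by (auto simp: refl_on_def refl elim!: Field_power_cases)
  show "P \<subseteq> Field P \<times> Field P"
    by (auto intro: FieldI1 FieldI2)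
  show "trans P"
  proof (rule transI)
    fix x y z assume "(x, y) \<in> P" "(y, z) \<in> P"
    note xy = \<open>(x, y) \<in> P\<close>
    from \<open>(y, z) \<in> P\<close> show "(x, z) \<in> P"
    proof (cases rule: in_power_complex_cases)
      case (3 F G S)
      from \<open>(x, y) \<in> P\<close> show ?thesis
      proof (cases rule: in_power_complex_cases)
        case (2 F' S')
        then show ?thesis
          using \<open>(y, z) \<in> P\<close> by (auto intro: None_power_le FieldI2)
      next
        case (3 F' G' S')
        then show ?thesis
          using \<open>(y, z) \<in> P\<close> \<open>z = Some (G, S - vs G)\<close> face_vertices_mono trans by (auto 4 4)
      qed (use 3 in auto)
    qed (use xy in \<open>auto elim!: in_power_complex_cases\<close>)
  qed
  show "antisym P"
    by (rule antisymI) (auto elim!: in_power_complex_cases dest: antisym)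
qed

lemma finite_Field_power: "finite (Field P)"
proof (rule finite_subset)
  show "Field P \<subseteq> insert None (Some ` (Field r \<times> Pow V))"
    by (auto elim!: Field_power_cases)
  have "finite V"
    by (simp add: faces_def finite_Field)
  then show "finite (insert None (Some ` (Field r \<times> Pow V)))"
    using finite_Field by simp
qed

lemma is_least_power: "is_least P x \<longleftrightarrow> x = None"
proof
  assume "is_least P x"
  then have "(x, None) \<in> P"
    by (simp add: is_least_def)
  then show "x = None"
    by (cases x) auto
qed (simp add: is_least_def None_power_le)

lemma least_face_power: "least_face P = None"
  by (simp add: least_face_def is_least_power)

lemma is_greatest_power: "is_greatest P x \<longleftrightarrow> x = Some (top, {})"
proof
  show "is_greatest P x" if "x = Some (top, {})"
    using that le_top top_in face_vertices_top
    by (auto simp: is_greatest_def elim!: Field_power_cases)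
  assume "is_greatest P x"
  then have "(Some (top, {}), x) \<in> P"
    by (simp add: is_greatest_def top_in)
  then show "x = Some (top, {})"
    by (cases rule: in_power_complex_cases) (auto dest: antisym le_top FieldI2)
qed

lemma greatest_face_power: "greatest_face P = Some (top, {})"
  by (simp add: greatest_face_def is_greatest_power)

lemma faces_0_power: "faces 0 P (power_rank rk) = {Some (bot, S) | S. S \<subseteq> V}"
proof -
  have "rk F + 1 = 0 \<longleftrightarrow> F = bot" if "F \<in> Field r" for F
    using rk_eq_minus_one_iff[OF that] by (metis add.commute add_eq_0_iff)
  moreover have "x \<in> faces 0 P (power_rank rk) \<longleftrightarrow>
      (\<exists>F S. x = Some (F, S) \<and> F \<in> Field r \<and> rk F + 1 = 0 \<and> S \<subseteq> V - vs F)" for x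
  proof (cases x)
    case None
    then show ?thesis
      unfolding faces_def by simp
  next
    case (Some a)
    then show ?thesis
      unfolding faces_def[of _ P] by (cases a) auto
  qed
  ultimately show ?thesis
    using bot_in face_vertices_bot by auto
qed

section \<open>Flags of the power complex: a vector together with a flag of \<open>K\<close>\<close>

definition power_flag :: "'a set \<Rightarrow> 'a set \<Rightarrow> ('a \<times> 'a set) option set" where
  "power_flag S \<Phi> = insert None ((\<lambda>F. Some (F, S - vs F)) ` \<Phi>)"

text \<open>A cube comparable with all of \<open>power_flag S \<Phi>\<close> has its first component
  comparable with all of \<open>\<Phi>\<close>, hence in \<open>\<Phi>\<close>. Comparison with the
  vertex \<open>Some (bot, S)\<close> then determines the second component.\<close>

lemma power_flag_in_flags:
  assumes "S \<subseteq> V" "\<Phi> \<in> flags r"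
  shows "power_flag S \<Phi> \<in> flags P"
proof -
  have chain: "power_flag S \<Phi> \<in> Chains P"
    using assms flag_comparable[OF assms(2)] flags_Field[OF assms(2)]
    by (fastforce simp: Chains_def power_flag_def dest: face_vertices_mono)
  have "D \<subseteq> power_flag S \<Phi>" if D: "D \<in> Chains P" "power_flag S \<Phi> \<subseteq> D" for D
  proof
    fix x assume x: "x \<in> D"
    have comp: "(x, y) \<in> P \<or> (y, x) \<in> P" if "y \<in> power_flag S \<Phi>" for y
      using x D that by (auto simp: Chains_def)
    show "x \<in> power_flag S \<Phi>"
    proof (cases x)
      case None
      then show ?thesis by (simp add: power_flag_def)
    next
      case (Some a)
      then obtain F T where xFT: "x = Some (F, T)"
        by (cases a) auto
      have comp': "(F, G) \<in> r \<and> S - vs G = T - vs G \<or> (G, F) \<in> r \<and> T = (S - vs G) - vs F" if "G \<in> \<Phi>" for G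
        using comp[of "Some (G, S - vs G)"] that xFT by (auto simp: power_flag_def)
      then have "F \<in> \<Phi>"
        using flag_maximal[OF assms(2), of F] bot_in_flag[OF assms(2)]
        by (metis FieldI1 FieldI2)
      moreover have "T = S - vs F"
        using comp'[OF bot_in_flag[OF assms(2)]] le_bot_iff face_vertices_bot by auto
      ultimately show ?thesis
        using xFT by (simp add: power_flag_def)
    qed
  qed
  then show ?thesis
    using chain unfolding flags_def by blast
qed

text \<open>In a chain the second component of the lowest cube determines those of all cubes above
  it. With the first components extended to a flag of \<open>K\<close>, the chain lies in some
  \<open>power_flag S \<Phi>\<close>, and maximality gives equality.\<close>

lemma flags_power_cases:
  assumes C: "C \<in> flags P"
  obtains S \<Phi> where "S \<subseteq> V" "\<Phi> \<in> flags r" "C = power_flag S \<Phi>"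
proof -
  have chain: "C \<in> Chains P" and max: "\<And>D. D \<in> Chains P \<Longrightarrow> C \<subseteq> D \<Longrightarrow> D = C"
    using C by (auto simp: flags_def)
  have sub: "C \<subseteq> Field P"
    using chain by (auto simp: Chains_def intro: FieldI1)
  have comp: "(x, y) \<in> P \<or> (y, x) \<in> P" if "x \<in> C" "y \<in> C" for x y
    using chain that by (auto simp: Chains_def)
  \<comment> \<open>The greatest face ensures that \<open>C\<close> contains some face other than
    \<open>None\<close>, so that a lowest cube exists.\<close>
  have "(x, Some (top, {})) \<in> P" if "x \<in> Field P" for x
    using is_greatest_power that by (auto simp: is_greatest_def)
  then have "insert (Some (top, {})) C \<in> Chains P"
    using chain sub le_top top_in by (auto simp: Chains_def)
  then have "Some (top, {}) \<in> C"
    using max by blast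
  define \<Phi>0 where "\<Phi>0 = {F. \<exists>T. Some (F, T) \<in> C}"
  have "\<Phi>0 \<in> Chains r"
    unfolding Chains_def \<Phi>0_def using comp by fastforce
  have \<Phi>0_sub: "\<Phi>0 \<subseteq> Field r"
    using sub by (auto simp: \<Phi>0_def)
  have "finite (rk ` \<Phi>0)"
    using \<Phi>0_sub finite_Field finite_subset by blast
  moreover have "\<Phi>0 \<noteq> {}"
    using \<open>Some (top, {}) \<in> C\<close> by (auto simp: \<Phi>0_def)
  ultimately obtain G where G: "G \<in> \<Phi>0" "\<And>F. F \<in> \<Phi>0 \<Longrightarrow> rk G \<le> rk F"
    using Min_in[of "rk ` \<Phi>0"] Min_le[of "rk ` \<Phi>0"] by (metis (no_types, lifting) image_iff image_is_empty)
  then obtain S where S: "Some (G, S) \<in> C"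
    by (auto simp: \<Phi>0_def)
  obtain \<Phi> where \<Phi>: "\<Phi> \<in> flags r" "\<Phi>0 \<subseteq> \<Phi>"
    using chain_extends_to_flag[OF \<open>\<Phi>0 \<in> Chains r\<close>] .
  have "S \<subseteq> V"
    using S sub Some_in_Field_power by blast
  have "C \<subseteq> power_flag S \<Phi>"
  proof
    fix x assume x: "x \<in> C"
    show "x \<in> power_flag S \<Phi>"
    proof (cases x)
      case None
      then show ?thesis by (simp add: power_flag_def)
    next
      case (Some a)
      then obtain F T where xFT: "x = Some (F, T)"
        by (cases a) auto
      then have "F \<in> \<Phi>0"
        using x by (auto simp: \<Phi>0_def)
      have "(Some (G, S), x) \<in> P"
      proof (rule ccontr)
        assume neg: "(Some (G, S), x) \<notin> P"
        then have le: "(x, Some (G, S)) \<in> P"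
          using comp[OF x S] by blast
        then have "F = G"
          using G(2)[OF \<open>F \<in> \<Phi>0\<close>] xFT rank_strict_mono[of F G] by fastforce
        then show False
          using le neg xFT by auto
      qed
      then show ?thesis
        using xFT \<open>F \<in> \<Phi>0\<close> \<Phi>(2) by (auto simp: power_flag_def)
    qed
  qed
  then have "C = power_flag S \<Phi>"
    using power_flag_in_flags[OF \<open>S \<subseteq> V\<close> \<Phi>(1)] max by (auto simp: flags_def)
  then show ?thesis
    using that \<open>S \<subseteq> V\<close> \<Phi>(1) by blast
qed

lemma inj_power_flag_face: "inj_on (\<lambda>F. Some (F, S - vs F)) A"
  by (rule inj_onI) simp

lemma card_power_flag:
  assumes "\<Phi> \<in> flags r"
  shows "card (power_flag S \<Phi>) = m + 3"
proof -
  have "finite \<Phi>"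
    using flags_Field[OF assms] finite_Field finite_subset by blast
  then have "card (power_flag S \<Phi>) = Suc (card \<Phi>)"
    unfolding power_flag_def by (subst card_insert_disjoint) (auto simp: card_image[OF inj_power_flag_face])
  then show ?thesis
    using flag_card[OF assms] by simp
qed

lemma adjacent_power_flag:
  assumes "adjacent \<Phi> \<Psi>"
  shows "adjacent (power_flag S \<Phi>) (power_flag S \<Psi>)"
proof -
  have "power_flag S \<Phi> - power_flag S \<Psi> = (\<lambda>F. Some (F, S - vs F)) ` (\<Phi> - \<Psi>)" for \<Phi> \<Psi>
    by (auto simp: power_flag_def)
  then show ?thesis
    using assms by (simp add: adjacent_def card_image[OF inj_power_flag_face])
qed

lemma flag_vertex_le:
  assumes "\<Phi> \<in> flags r" "v \<in> \<Phi>" "v \<in> V" "F \<in> \<Phi>" "F \<noteq> bot"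
  shows "(v, F) \<in> r"
proof (rule flag_le[OF assms(1,2,4)])
  have "F \<in> Field r"
    using assms flags_Field by blast
  then show "rk v \<le> rk F"
    using assms rk_range[of F] rk_eq_minus_one_iff[of F] by (auto simp: faces_def)
qed

text \<open>Every face of \<open>\<Phi>\<close> except \<open>bot\<close> contains the vertex
  \<open>v\<close>, so its cube leaves the coordinate \<open>v\<close> free. Flipping that
  coordinate of \<open>S\<close> replaces the vertex \<open>Some (bot, S)\<close> and nothing
  else.\<close>

lemma adjacent_power_flag_flip:
  assumes "\<Phi> \<in> flags r" "v \<in> \<Phi>" "v \<in> V" "S \<subseteq> V"
  shows "adjacent (power_flag S \<Phi>) (power_flag (sym_diff S {v}) \<Phi>)"
proof -
  have eq: "sym_diff S {v} - vs F = S - vs F" if "F \<in> \<Phi>" "F \<noteq> bot" for F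
    using flag_vertex_le[OF assms(1-3) that] assms(3) by (auto simp: face_vertices_def)
  define X where "X = insert None ((\<lambda>F. Some (F, S - vs F)) ` (\<Phi> - {bot}))"
  have flag: "power_flag T \<Phi> = insert (Some (bot, T)) X" if "\<And>F. F \<in> \<Phi> \<Longrightarrow> F \<noteq> bot \<Longrightarrow> T - vs F = S - vs F" for T
  proof -
    have "power_flag T \<Phi> = insert None ((\<lambda>F. Some (F, T - vs F)) ` insert bot (\<Phi> - {bot}))"
      using bot_in_flag[OF assms(1)] by (simp add: power_flag_def insert_absorb)
    also have "\<dots> = insert (Some (bot, T)) (insert None ((\<lambda>F. Some (F, T - vs F)) ` (\<Phi> - {bot})))"
      by (simp only: image_insert face_vertices_bot Diff_empty insert_commute)
    also have "(\<lambda>F. Some (F, T - vs F)) ` (\<Phi> - {bot}) = (\<lambda>F. Some (F, S - vs F)) ` (\<Phi> - {bot})"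
      using that by (intro image_cong) auto
    finally show ?thesis by (simp add: X_def)
  qed
  have "Some (bot, T) \<notin> X" for T
    by (auto simp: X_def)
  moreover have "S \<noteq> sym_diff S {v}"
    by auto
  ultimately have "power_flag S \<Phi> - power_flag (sym_diff S {v}) \<Phi> = {Some (bot, S)}"
    "power_flag (sym_diff S {v}) \<Phi> - power_flag S \<Phi> = {Some (bot, sym_diff S {v})}"
    using flag[of S] flag[of "sym_diff S {v}"] eq by auto
  then show ?thesis
    by (simp add: adjacent_def)
qed

text \<open>The set of faces to be kept is a parameter \<open>X\<close> instead of the intersection
  of the two ends, because the induction below moves one end while keeping \<open>X\<close>.\<close>

abbreviation flag_steps :: "'b rel \<Rightarrow> 'b set \<Rightarrow> 'b set rel" where
  "flag_steps Q X \<equiv> {(C, D). C \<in> flags Q \<and> D \<in> flags Q \<and> X \<subseteq> C \<and> X \<subseteq> D \<and> adjacent C D}"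

lemma power_flag_connected_same:
  assumes "S \<subseteq> V" "\<Phi> \<in> flags r" "\<Psi> \<in> flags r"
    and X: "X \<subseteq> power_flag S \<Phi> \<inter> power_flag S \<Psi>"
  shows "(power_flag S \<Phi>, power_flag S \<Psi>) \<in> (flag_steps P X)\<^sup>*"
proof -
  have X': "X \<subseteq> power_flag S (\<Phi> \<inter> \<Psi>)"
    using X by (auto simp: power_flag_def)
  have "(\<Phi>, \<Psi>) \<in> (flag_steps r (\<Phi> \<inter> \<Psi>))\<^sup>*"
    using flag_connected assms unfolding strongly_flag_connected_def by blast
  then show ?thesis
  proof (induction rule: rtrancl_induct)
    case (step \<Phi>' \<Psi>')
    have mono: "X \<subseteq> power_flag S \<Theta>" if "\<Phi> \<inter> \<Psi> \<subseteq> \<Theta>" for \<Theta>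
      using X' that by (auto simp: power_flag_def)
    have "(power_flag S \<Phi>', power_flag S \<Psi>') \<in> flag_steps P X"
      using step.hyps power_flag_in_flags[OF assms(1)] adjacent_power_flag mono by auto
    then show ?case
      using step.IH by (rule rtrancl_into_rtrancl[rotated])
  qed simp
qed

text \<open>Each face other than \<^term>\<open>None\<close> common to both flags contains all vertices in which \<open>S\<close> and \<open>T\<close> differ. So for such a
  vertex \<open>v\<close> one may change \<open>\<Phi>\<close> to a flag \<open>\<Theta>\<close> through \<open>v\<close> keeping the common faces, and then flip the
  coordinate \<open>v\<close>, which affects only the vertex of the power complex in the flag.\<close>

lemma power_flag_connected:
  assumes "S \<subseteq> V" "T \<subseteq> V" "\<Phi> \<in> flags r" "\<Psi> \<in> flags r"
    and "X \<subseteq> power_flag S \<Phi> \<inter> power_flag T \<Psi>"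
  shows "(power_flag S \<Phi>, power_flag T \<Psi>) \<in> (flag_steps P X)\<^sup>*"
  using assms
proof (induction "card (sym_diff S T)" arbitrary: S \<Phi>)
  case 0
  have "sym_diff S T \<subseteq> Field r"
    using 0 by (auto simp: faces_def)
  then have "S = T"
    using 0 finite_subset[OF _ finite_Field] by auto
  then show ?case
    using power_flag_connected_same 0 by auto
next
  case (Suc k)
  have "sym_diff S T \<subseteq> Field r"
    using Suc.prems by (auto simp: faces_def)
  then have fin: "finite (sym_diff S T)"
    using finite_subset finite_Field by blast
  obtain v where v: "v \<in> sym_diff S T"
    using Suc.hyps(2) by (metis card.empty ex_in_conv nat.distinct(1))
  then have vV: "v \<in> V"
    using Suc.prems by auto
  let ?S' = "sym_diff S {v}"
  have "sym_diff ?S' T = sym_diff S T - {v}"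
    using v by auto
  then have card: "k = card (sym_diff ?S' T)"
    using Suc.hyps(2) v fin by simp
  have S': "?S' \<subseteq> V"
    using Suc.prems vV by auto
  let ?C = "{F \<in> \<Phi>. (v, F) \<in> r}"
  have "insert v ?C \<in> Chains r"
    using flag_comparable[OF Suc.prems(3)] vV refl by (auto simp: Chains_def faces_def)
  then obtain \<Theta> where \<Theta>: "\<Theta> \<in> flags r" "insert v ?C \<subseteq> \<Theta>"
    by (rule chain_extends_to_flag)
  have X: "X \<subseteq> power_flag S \<Theta> \<and> X \<subseteq> power_flag ?S' \<Theta>"
  proof -
    have "x \<in> power_flag S \<Theta> \<and> x \<in> power_flag ?S' \<Theta>" if "x \<in> X" for x
    proof (cases x)
      case None
      then show ?thesis by (simp add: power_flag_def)
    next
      case (Some a)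
      moreover have "x \<in> power_flag S \<Phi>" "x \<in> power_flag T \<Psi>"
        using Suc.prems(5) that by auto
      ultimately obtain F where F: "F \<in> \<Phi>" "F \<in> \<Psi>" "x = Some (F, S - vs F)" "S - vs F = T - vs F"
        by (auto simp: power_flag_def)
      then have "v \<in> vs F"
        using v by auto
      then have "F \<in> \<Theta>" "?S' - vs F = S - vs F"
        using \<Theta>(2) F by (auto simp: face_vertices_def)
      then show ?thesis
        using F by (auto simp: power_flag_def)
    qed
    then show ?thesis by blast
  qed
  have "(power_flag S \<Phi>, power_flag S \<Theta>) \<in> (flag_steps P X)\<^sup>*"
    using power_flag_connected_same[OF Suc.prems(1,3) \<Theta>(1)] X Suc.prems(5) by blast
  also have "(power_flag S \<Theta>, power_flag ?S' \<Theta>) \<in> flag_steps P X"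
    using X power_flag_in_flags \<Theta> S' Suc.prems(1) adjacent_power_flag_flip[OF \<Theta>(1) _ vV Suc.prems(1)] by auto
  also have "(power_flag ?S' \<Theta>, power_flag T \<Psi>) \<in> (flag_steps P X)\<^sup>*"
    using Suc.hyps(1)[OF card S' Suc.prems(2) \<Theta>(1) Suc.prems(4)] X Suc.prems(5) by blast
  finally show ?case .
qed

section \<open>Diamond condition and the polytope axioms for the power complex\<close>

lemma power_diamond:
  assumes "(x, y) \<in> P" "power_rank rk y - power_rank rk x = 2"
  shows "card {H. (x, H) \<in> P \<and> H \<noteq> x \<and> (H, y) \<in> P \<and> H \<noteq> y} = 2"
  using assms(1)
proof (cases rule: in_power_complex_cases)
  \<comment> \<open>Above \<open>None\<close> the rank difference makes \<open>y\<close> an edge: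
    the one free coordinate is \<open>v\<close>, and its two ends have that coordinate 0 or
    1.\<close>
  case (2 v S)
  then have v: "v \<in> V"
    using assms(2) by (simp add: faces_def)
  have vS: "vs v = {v}"
    using face_vertices_vertex[OF v] .
  have "F = bot" if "(F, v) \<in> r" "F \<noteq> v" for F
    using rank_strict_mono[OF that] v rk_range[of F] rk_eq_minus_one_iff[of F] FieldI1[OF that(1)]
    by (auto simp: faces_def)
  moreover have "bot \<noteq> v"
    using v rk_bot by (auto simp: faces_def)
  ultimately have "{H. (x, H) \<in> P \<and> H \<noteq> x \<and> (H, y) \<in> P \<and> H \<noteq> y} = {Some (bot, S), Some (bot, insert v S)}"
    (is "?M = _")
  proof (intro equalityI subsetI)
    fix H assume "H \<in> ?M"
    then obtain a where "H = Some a" "(H, y) \<in> P" "H \<noteq> y"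
      using 2 by (cases H) auto
    then obtain F T where H: "H = Some (F, T)" "(F, v) \<in> r" "T \<subseteq> V - vs F" "S = T - {v}" "H \<noteq> y"
      using 2 vS by (cases a) auto
    have "F \<noteq> v"
    proof
      assume "F = v"
      then have "T = S"
        using H vS by blast
      then show False
        using H 2 \<open>F = v\<close> by simp
    qed
    then have "F = bot"
      using H \<open>\<And>F. (F, v) \<in> r \<Longrightarrow> F \<noteq> v \<Longrightarrow> F = bot\<close> by blast
    then show "H \<in> {Some (bot, S), Some (bot, insert v S)}"
      using H by auto
  qed (use 2 v vS bot_in bot_le face_vertices_bot \<open>bot \<noteq> v\<close> in auto)
  moreover have "S \<noteq> insert v S"
    using 2(4) vS by blast
  ultimately show ?thesis
    by simp
next
  \<comment> \<open>Above a cube the second components are forced, so the interval is a copy of the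
    section between \<open>F\<close> and \<open>G\<close> in \<open>K\<close>.\<close>
  case (3 F G S)
  have "{H. (x, H) \<in> P \<and> H \<noteq> x \<and> (H, y) \<in> P \<and> H \<noteq> y} =
    (\<lambda>H. Some (H, S - vs H)) ` {H. (F, H) \<in> r \<and> H \<noteq> F \<and> (H, G) \<in> r \<and> H \<noteq> G}" (is "?L = ?R")
  proof (intro equalityI subsetI)
    fix H assume H: "H \<in> ?L"
    then have H': "(x, H) \<in> P" "H \<noteq> x" "(H, y) \<in> P" "H \<noteq> y"
      by simp_all
    obtain E where E: "H = Some (E, S - vs E)" "(F, E) \<in> r"
      using H'(1) unfolding 3(1) by (cases rule: in_power_complex_cases) auto
    then have "(E, G) \<in> r"
      using H'(3) 3(2) by simp
    moreover have "S - vs F = S"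
      using 3(4) by blast
    then have "E \<noteq> F" "E \<noteq> G"
      using H'(2,4) 3(1,2) E(1) by metis+
    ultimately show "H \<in> ?R"
      using E by blast
  next
    fix H assume "H \<in> ?R"
    then obtain E where "H = Some (E, S - vs E)" "(F, E) \<in> r" "E \<noteq> F" "(E, G) \<in> r" "E \<noteq> G"
      by auto
    moreover have "S - vs E \<subseteq> V - vs E" "S - vs G = S - vs E - vs G"
      using 3(4) face_vertices_mono[OF \<open>(E, G) \<in> r\<close>] by auto
    ultimately show "H \<in> ?L"
      using 3 by simp
  qed
  moreover have "rk G - rk F = 2"
    using assms(2) 3(1,2) by simp
  ultimately show ?thesis
    using diamond[OF 3(3)] by (simp only: card_image[OF inj_power_flag_face])
qed (use assms(2) in simp)

theorem abstract_polytope_power: "abstract_polytope (m + 1) P (power_rank rk)"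
proof
  show "Partial_order P" by (rule Partial_order_power)
  show "\<exists>x. is_least P x" "\<exists>x. is_greatest P x"
    by (simp_all add: is_least_power is_greatest_power)
  show "power_rank rk x < power_rank rk y" if "(x, y) \<in> P" "x \<noteq> y" for x y
    using that(1)
  proof (cases rule: in_power_complex_cases)
    case (3 F G S)
    then show ?thesis
      using that(2) rank_strict_mono[of F G] by fastforce
  next
    case (2 F S)
    then show ?thesis
      using rk_range[of F] by simp
  qed (use that(2) in simp)
  show "power_rank rk ` Field P = {-1..int (m + 1)}"
  proof (intro equalityI subsetI)
    fix i assume "i \<in> {-1..int (m + 1)}"
    then have "i = -1 \<or> i - 1 \<in> rk ` Field r"
      using rank_onto by auto
    then show "i \<in> power_rank rk ` Field P"
    proof
      assume "i - 1 \<in> rk ` Field r"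
      then obtain F where "F \<in> Field r" "rk F = i - 1"
        by auto
      then show ?thesis
        by (intro image_eqI[of _ _ "Some (F, {})"]) auto
    qed (auto intro!: image_eqI[of _ _ None])
  next
    fix i assume "i \<in> power_rank rk ` Field P"
    then obtain x where "x \<in> Field P" "i = power_rank rk x"
      by blast
    then show "i \<in> {-1..int (m + 1)}"
      using rk_range by (cases rule: Field_power_cases) force+
  qed
  show "card C = m + 1 + 2" if "C \<in> flags P" for C
    using that by (auto elim!: flags_power_cases simp: card_power_flag)
  show "strongly_flag_connected P"
    unfolding strongly_flag_connected_def
  proof (intro ballI)
    fix A B assume "A \<in> flags P" "B \<in> flags P"
    then show "(A, B) \<in> (flag_steps P (A \<inter> B))\<^sup>*"
      by (auto elim!: flags_power_cases intro!: power_flag_connected)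
  qed
  show "card {H. (x, H) \<in> P \<and> H \<noteq> x \<and> (H, y) \<in> P \<and> H \<noteq> y} = 2"
    if "(x, y) \<in> P" "power_rank rk y - power_rank rk x = 2" for x y
    using power_diamond[OF that] .
qed

end

lemma automorphism_face_section:
  assumes "automorphism r f" "F \<in> Field r" "G \<in> Field r" "f F = F" "f G = G"
  shows "automorphism (face_section r F G) f"
proof -
  obtain f' where f': "automorphism r f'" "\<And>x. x \<in> Field r \<Longrightarrow> f' (f x) = x"
    "\<And>x. x \<in> Field r \<Longrightarrow> f (f' x) = x"
    using automorphism_inverse[OF assms(1)] by metis
  have fix_f': "f' F = F" "f' G = G"
    using f'(2) assms by metis+
  have mono: "(h x, h y) \<in> face_section r F G"
    if "automorphism r h" "h F = F" "h G = G" "(x, y) \<in> face_section r F G" for h x y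
    using that(4) automorphism_mono[OF that(1)] that(2,3) unfolding face_section_iff by metis
  have sub: "x \<in> Field r" if "x \<in> Field (face_section r F G)" for x
    using that by (auto simp: Field_def face_section_iff)
  show ?thesis
    using mono[OF assms(1,4,5)] mono[OF f'(1) fix_f'] f'(2,3) sub
    by (intro automorphismI[of _ f f']) simp_all
qed

lemma rtrancl_image:
  assumes "(x, y) \<in> p\<^sup>*" "\<And>x y. (x, y) \<in> p \<Longrightarrow> (f x, f y) \<in> q"
  shows "(f x, f y) \<in> q\<^sup>*"
  using assms(1) by (induction rule: rtrancl_induct) (auto intro: rtrancl_into_rtrancl assms(2))

section \<open>Transport along isomorphisms\<close>

text \<open>Naming the inverse \<open>d\<close> makes the notion symmetric, so each fact about
  \<open>e\<close> also holds for \<open>d\<close> via \<open>inverse\<close>, and provides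
  \<open>rk \<circ> d\<close> as the transported rank.\<close>

locale order_isomorphism =
  fixes r :: "'a rel" and s :: "'b rel" and e :: "'a \<Rightarrow> 'b" and d :: "'b \<Rightarrow> 'a"
  assumes e_mono: "(x, y) \<in> r \<Longrightarrow> (e x, e y) \<in> s"
    and d_mono: "(x', y') \<in> s \<Longrightarrow> (d x', d y') \<in> r"
    and d_e: "x \<in> Field r \<Longrightarrow> d (e x) = x"
    and e_d: "x' \<in> Field s \<Longrightarrow> e (d x') = x'"
begin

lemma e_Field: "x \<in> Field r \<Longrightarrow> e x \<in> Field s"
  using e_mono unfolding Field_def by blast

lemma d_Field: "x \<in> Field s \<Longrightarrow> d x \<in> Field r"
  using d_mono unfolding Field_def by blast

lemma e_iff: "x \<in> Field r \<Longrightarrow> y \<in> Field r \<Longrightarrow> (e x, e y) \<in> s \<longleftrightarrow> (x, y) \<in> r"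
  using e_mono d_mono d_e by metis

lemma inverse: "order_isomorphism s r d e"
  by unfold_locales (auto simp: e_mono d_mono d_e e_d)

lemma inj_e: "inj_on e (Field r)"
  by (rule inj_on_inverseI[of _ d]) (rule d_e)

lemma image_e: "e ` Field r = Field s"
  using e_Field d_Field e_d by force

lemma iso_e: "iso r s e"
  unfolding iso_iff2 bij_betw_def by (auto simp: inj_e image_e e_iff)

lemma section_isomorphism:
  assumes "F \<in> Field r" "G \<in> Field r"
  shows "order_isomorphism (face_section r F G) (face_section s (e F) (e G)) e d"
proof
  show "(e x, e y) \<in> face_section s (e F) (e G)" if "(x, y) \<in> face_section r F G" for x y
    using that e_mono by (auto simp: face_section_iff)
  show "(d x, d y) \<in> face_section r F G" if "(x, y) \<in> face_section s (e F) (e G)" for x y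
    using that d_mono d_e assms by (metis face_section_iff)
  show "d (e x) = x" if "x \<in> Field (face_section r F G)" for x
    using that by (intro d_e) (auto simp: Field_def face_section_iff)
  show "e (d x) = x" if "x \<in> Field (face_section s (e F) (e G))" for x
    using that by (intro e_d) (auto simp: Field_def face_section_iff)
qed

lemma automorphism_conj:
  assumes "automorphism r f"
  shows "automorphism s (e \<circ> f \<circ> d)"
proof -
  obtain f' where f': "automorphism r f'" "\<And>x. x \<in> Field r \<Longrightarrow> f' (f x) = x"
    "\<And>x. x \<in> Field r \<Longrightarrow> f (f' x) = x"
    using automorphism_inverse[OF assms(1)] by metis
  show ?thesis
    by (rule automorphismI[of _ _ "e \<circ> f' \<circ> d"])
      (simp_all add: e_mono d_mono automorphism_mono[OF assms] automorphism_mono[OF f'(1)]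
        d_e e_d f' d_Field automorphism_Field[OF assms] automorphism_Field[OF f'(1)])
qed

lemma Chains_image: "C \<in> Chains r \<Longrightarrow> e ` C \<in> Chains s"
  unfolding Chains_def using e_mono by auto

lemma image_d_e: "C \<subseteq> Field r \<Longrightarrow> d ` e ` C = C"
  using d_e by (force simp: image_image)

lemma flags_image:
  assumes "C \<in> flags r"
  shows "e ` C \<in> flags s"
proof -
  interpret inv: order_isomorphism s r d e by (rule inverse)
  have C: "C \<in> Chains r" "\<And>D. D \<in> Chains r \<Longrightarrow> C \<subseteq> D \<Longrightarrow> D = C"
    using assms by (auto simp: flags_def)
  have "D = e ` C" if D: "D \<in> Chains s" "e ` C \<subseteq> D" for D
  proof -
    have "C \<subseteq> d ` D"
      using image_mono[OF D(2), of d] image_d_e[OF Chains_Field[OF C(1)]] by simp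
    then have "d ` D = C"
      using C(2) inv.Chains_image[OF D(1)] by blast
    then show ?thesis
      using inv.image_d_e[OF Chains_Field[OF D(1)]] by simp
  qed
  then show ?thesis
    using Chains_image[OF C(1)] by (auto simp: flags_def)
qed

lemma adjacent_image:
  assumes "A \<subseteq> Field r" "B \<subseteq> Field r" "adjacent A B"
  shows "adjacent (e ` A) (e ` B)"
proof -
  have "card (e ` A - e ` B) = card (A - B)" if "A \<subseteq> Field r" "B \<subseteq> Field r" for A B
  proof -
    have "e ` A - e ` B = e ` (A - B)"
      using inj_on_image_set_diff[OF inj_e, of A B] that by auto
    moreover have "inj_on e (A - B)"
      using inj_e that by (auto elim: inj_on_subset)
    ultimately show ?thesis
      by (simp add: card_image)
  qed
  then show ?thesis
    using assms by (simp add: adjacent_def)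
qed

lemma is_least_transport:
  assumes "is_least r x" shows "is_least s (e x)"
  using assms unfolding is_least_def using e_Field e_mono d_Field e_d by metis

lemma is_greatest_transport:
  assumes "is_greatest r x" shows "is_greatest s (e x)"
  using assms unfolding is_greatest_def using e_Field e_mono d_Field e_d by metis

lemma abstract_polytope_transport:
  assumes "abstract_polytope m r rk"
  shows "abstract_polytope m s (rk \<circ> d)"
proof -
  interpret r: abstract_polytope m r rk by fact
  interpret inv: order_isomorphism s r d e by (rule inverse)
  have r: "\<And>x. x \<in> Field r \<Longrightarrow> (x, x) \<in> r" "trans r" "antisym r"
    using r.partial_order by (auto simp: order_on_defs refl_on_def)
  have d_iff: "x \<in> Field s \<Longrightarrow> y \<in> Field s \<Longrightarrow> (x, y) \<in> s \<longleftrightarrow> (d x, d y) \<in> r" for x y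
    using inv.e_iff by simp
  show ?thesis
  proof
    show "Partial_order s"
      unfolding order_on_defs
    proof (intro conjI)
      show "refl_on (Field s) s" "s \<subseteq> Field s \<times> Field s"
        using r(1) d_iff d_Field by (auto simp: refl_on_def intro: FieldI1 FieldI2)
      show "trans s"
        using d_iff r(2) by (meson FieldI1 FieldI2 transD transI)
      show "antisym s"
        by (rule antisymI) (metis r(3) antisymD d_mono e_d FieldI1)
    qed
    show "\<exists>x. is_least s x"
      using r.least is_least_transport by blast
    show "\<exists>x. is_greatest s x"
      using r.greatest is_greatest_transport by blast
    show "(rk \<circ> d) x < (rk \<circ> d) y" if "(x, y) \<in> s" "x \<noteq> y" for x y
      using r.rank_strict_mono[of "d x" "d y"] d_mono[OF that(1)] that e_d[of x] e_d[of y]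
      by (metis FieldI1 FieldI2 comp_apply)
    show "(rk \<circ> d) ` Field s = {-1..int m}"
      using r.rank_onto inv.image_e by (metis image_comp)
    \<comment> \<open>Flag axioms for \<open>s\<close> are read off from the image under
      \<open>d\<close>: cardinalities agree by injectivity, and paths of flags come back along
      \<open>e\<close>.\<close>
    have pull: "d ` C \<in> flags r" "e ` d ` C = C" "C \<subseteq> Field s" if "C \<in> flags s" for C
    proof -
      show "d ` C \<in> flags r"
        using inv.flags_image[OF that] .
      show "C \<subseteq> Field s"
        using that by (rule flags_Field)
      then show "e ` d ` C = C"
        by (rule inv.image_d_e)
    qed
    show "card C = m + 2" if "C \<in> flags s" for C
      using r.flag_card[OF pull(1)[OF that]] card_image[OF inj_on_subset[OF inv.inj_e pull(3)[OF that]]]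
      by simp
    show "strongly_flag_connected s"
      unfolding strongly_flag_connected_def
    proof (intro ballI)
      fix A B assume A: "A \<in> flags s" and B: "B \<in> flags s"
      let ?R = "\<lambda>q A B. {(C, D). C \<in> flags q \<and> D \<in> flags q \<and> A \<inter> B \<subseteq> C \<and> A \<inter> B \<subseteq> D \<and> adjacent C D}"
      have "(d ` A, d ` B) \<in> (?R r (d ` A) (d ` B))\<^sup>*"
        using r.flag_connected pull(1) A B unfolding strongly_flag_connected_def by blast
      then have "(e ` d ` A, e ` d ` B) \<in> (?R s A B)\<^sup>*"
      proof (rule rtrancl_image[where f = "image e"])
        fix C D assume "(C, D) \<in> ?R r (d ` A) (d ` B)"
        then have CD: "C \<in> flags r" "D \<in> flags r" "d ` (A \<inter> B) \<subseteq> C" "d ` (A \<inter> B) \<subseteq> D" "adjacent C D"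
          by auto
        have "e ` d ` (A \<inter> B) = A \<inter> B"
          using pull(3)[OF A] by (intro inv.image_d_e) auto
        then have "A \<inter> B \<subseteq> e ` C" "A \<inter> B \<subseteq> e ` D"
          using image_mono[OF CD(3), of e] image_mono[OF CD(4), of e] by auto
        moreover have "adjacent (e ` C) (e ` D)"
          using flags_Field[OF CD(1)] flags_Field[OF CD(2)] CD(5) by (rule adjacent_image)
        ultimately show "(e ` C, e ` D) \<in> ?R s A B"
          using flags_image CD by auto
      qed
      then show "(A, B) \<in> (?R s A B)\<^sup>*"
        using pull(2) A B by simp
    qed
    show "card {H. (F, H) \<in> s \<and> H \<noteq> F \<and> (H, G) \<in> s \<and> H \<noteq> G} = 2" (is "card ?M = 2")
      if "(F, G) \<in> s" "(rk \<circ> d) G - (rk \<circ> d) F = 2" for F G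
    proof -
      let ?N = "{H. (d F, H) \<in> r \<and> H \<noteq> d F \<and> (H, d G) \<in> r \<and> H \<noteq> d G}"
      have FG: "F \<in> Field s" "G \<in> Field s"
        using that by (auto intro: FieldI1 FieldI2)
      have "?N = d ` ?M"
      proof (intro equalityI subsetI)
        fix H assume "H \<in> ?N"
        then show "H \<in> d ` ?M"
          using e_mono[of "d F" H] e_mono[of H "d G"] e_d FG d_e[of H] FieldI2[of "d F" H r]
          by (intro image_eqI[of _ _ "e H"]) auto
      next
        fix H assume "H \<in> d ` ?M"
        then obtain H' where H': "H = d H'" "(F, H') \<in> s" "H' \<noteq> F" "(H', G) \<in> s" "H' \<noteq> G"
          by blast
        then have "H \<noteq> d F" "H \<noteq> d G"
          using e_d FG FieldI2[OF H'(2)] by metis+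
        then show "H \<in> ?N"
          using H' d_mono by simp
      qed
      moreover have "?M \<subseteq> Field s"
        by (auto intro: FieldI2)
      then have "card (d ` ?M) = card ?M"
        by (intro card_image inj_on_subset[OF inv.inj_e])
      ultimately show ?thesis
        using r.diamond[of "d F" "d G"] d_mono[OF that(1)] that(2) by simp
    qed
  qed
qed

lemma faces_transport: "faces i s (rk \<circ> d) = e ` faces i r rk"
  unfolding faces_def image_e[symmetric] using d_e by (auto simp: image_iff)

lemma vertex_transitive_transport:
  assumes "vertex_transitive r rk"
  shows "vertex_transitive s (rk \<circ> d)"
  unfolding vertex_transitive_def
proof (intro ballI)
  fix u v assume "u \<in> faces 0 s (rk \<circ> d)" "v \<in> faces 0 s (rk \<circ> d)"
  then obtain u' v' where uv: "u' \<in> faces 0 r rk" "v' \<in> faces 0 r rk" "u = e u'" "v = e v'"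
    unfolding faces_transport by blast
  then obtain f where "automorphism r f" "f u' = v'"
    using assms unfolding vertex_transitive_def by blast
  moreover have "d u = u'"
    using uv d_e by (simp add: faces_def)
  ultimately show "\<exists>f. automorphism s f \<and> f u = v"
    using automorphism_conj uv(4) by (intro exI[of _ "e \<circ> f \<circ> d"]) simp
qed

text \<open>\<open>least_face\<close> is a definite description, so it follows \<open>e\<close> only
  once the least element of \<open>s\<close> is known to be unique; antisymmetry supplies
  this.\<close>

lemma least_face_transport:
  assumes "is_least r x" "antisym s" shows "least_face s = e x"
  unfolding least_face_def
  using is_least_transport[OF assms(1)] assms(2)
  by (intro the_equality) (auto simp: is_least_def dest: antisymD)

lemma greatest_face_transport:
  assumes "is_greatest r x" "antisym s" shows "greatest_face s = e x"
  unfolding greatest_face_def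
  using is_greatest_transport[OF assms(1)] assms(2)
  by (intro the_equality) (auto simp: is_greatest_def dest: antisymD)

lemma face_hereditary_transport:
  assumes "face_hereditary j r rk" "is_least r b" "antisym r" "antisym s"
  shows "face_hereditary j s (rk \<circ> d)"
  unfolding face_hereditary_def
proof (intro ballI allI impI)
  fix G g
  have lr: "least_face r = b"
    unfolding least_face_def using assms(2,3)
    by (intro the_equality) (auto simp: is_least_def dest: antisymD)
  have ls: "least_face s = e b"
    using least_face_transport assms(2,4) by blast
  assume "G \<in> faces (int j) s (rk \<circ> d)"
  then obtain F where F: "F \<in> faces (int j) r rk" "G = e F"
    unfolding faces_transport by blast
  let ?R = "face_section r b F" and ?S = "face_section s (e b) G"
  interpret sec: order_isomorphism ?R ?S e d
    using section_isomorphism[of b F] F assms(2) by (simp add: faces_def is_least_def)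
  interpret inv: order_isomorphism ?S ?R d e by (rule sec.inverse)
  assume "automorphism (face_section s (least_face s) G) g"
  then have g: "automorphism ?S g"
    by (simp add: ls)
  then obtain f where f: "automorphism r f" "\<forall>x\<in>Field ?R. f x = (d \<circ> g \<circ> e) x"
    using assms(1) F(1) inv.automorphism_conj[OF g] unfolding face_hereditary_def lr by blast
  have "(e \<circ> f \<circ> d) x = g x" if x: "x \<in> Field ?S" for x
    using f(2) sec.d_Field[OF x] sec.e_d[OF x] sec.e_d[OF automorphism_Field[OF g x]] by simp
  then show "\<exists>f. automorphism s f \<and> (\<forall>x\<in>Field (face_section s (least_face s) G). f x = g x)"
    using automorphism_conj[OF f(1)] by (metis ls)
qed

end

lemma order_isomorphism_trans:
  assumes "order_isomorphism r s e d" "order_isomorphism s t e' d'"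
  shows "order_isomorphism r t (e' \<circ> e) (d \<circ> d')"
proof -
  interpret a: order_isomorphism r s e d by fact
  interpret b: order_isomorphism s t e' d' by fact
  show ?thesis
    by unfold_locales (simp_all add: a.e_mono a.d_mono b.e_mono b.d_mono a.d_e a.e_d b.d_e b.e_d a.e_Field b.d_Field)
qed

text \<open>Moves the power complex to the type fixed by the conclusion.\<close>

lemma obtain_order_isomorphism_nat:
  assumes "finite (Field r)"
  obtains s :: "nat rel" and e d where "order_isomorphism r s e d"
proof -
  obtain e :: "'a \<Rightarrow> nat" where e: "inj_on e (Field r)"
    using finite_imp_inj_to_nat_seg[OF assms] by blast
  let ?s = "map_prod e e ` r" and ?d = "inv_into (Field r) e"
  have d: "?d (e x) = x" if "x \<in> Field r" for x
    using e that by simp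
  have "order_isomorphism r ?s e ?d"
  proof
    show "(?d x, ?d y) \<in> r" if "(x, y) \<in> ?s" for x y
      using that d by (auto simp: FieldI1 FieldI2)
    show "e (?d x) = x" if "x \<in> Field ?s" for x
    proof -
      have "x \<in> e ` Field r"
        using that by (auto simp: Field_def)
      then show ?thesis
        by (rule f_inv_into_f)
    qed
  qed (use d in auto)
  then show ?thesis
    using that by blast
qed

context finite_abstract_polytope
begin

section \<open>Automorphisms of the power complex\<close>

text \<open>Addition of the vector \<open>T\<close> modulo 2; removing \<open>vs F\<close> restores
  the normal form, in which free coordinates are 0.\<close>

definition translation :: "'a set \<Rightarrow> ('a \<times> 'a set) option \<Rightarrow> ('a \<times> 'a set) option" where
  "translation T = map_option (\<lambda>(F, S). (F, sym_diff S T - vs F))"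

lemma translation_simps [simp]:
  "translation T None = None"
  "translation T (Some (F, S)) = Some (F, sym_diff S T - vs F)"
  by (simp_all add: translation_def)

lemma translation_translation:
  assumes "x \<in> Field P" shows "translation T (translation T x) = x"
  using assms by (cases rule: Field_power_cases) auto

lemma automorphism_translation:
  assumes "T \<subseteq> V"
  shows "automorphism P (translation T)"
proof -
  have "(translation T x, translation T y) \<in> P" if "(x, y) \<in> P" for x y
    using that
  proof (cases rule: in_power_complex_cases)
    case (3 F G S)
    then have "sym_diff S T - vs F \<subseteq> V - vs F"
      using assms by auto
    moreover have "sym_diff (S - vs G) T - vs G = sym_diff S T - vs F - vs G"
      using face_vertices_mono[OF 3(3)] by auto
    ultimately show ?thesis
      using 3 by simp
  qed (use assms in auto)
  then show ?thesis
    using translation_translation by (intro automorphismI[of _ _ "translation T"])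
qed

definition power_lift :: "('a \<Rightarrow> 'a) \<Rightarrow> ('a \<times> 'a set) option \<Rightarrow> ('a \<times> 'a set) option" where
  "power_lift f = map_option (\<lambda>(F, S). (f F, f ` S))"

lemma power_lift_simps [simp]:
  "power_lift f None = None"
  "power_lift f (Some (F, S)) = Some (f F, f ` S)"
  by (simp_all add: power_lift_def)

text \<open>The order of \<open>P\<close> is expressed through \<open>r\<close>, \<open>V\<close>
  and \<open>vs\<close>. An automorphism respects all three and is injective on \<open>V\<close>, so
  taking images commutes with \<open>S - vs F\<close>.\<close>

lemma power_lift_mono:
  assumes "automorphism r f" "(x, y) \<in> P"
  shows "(power_lift f x, power_lift f y) \<in> P"
proof -
  have "inj_on f (Field r)"
    using assms(1) by (auto simp: automorphism_iff bij_betw_def)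
  then have inj: "inj_on f V"
    by (rule inj_on_subset) (auto simp: faces_def)
  have diff: "f ` S - vs (f F) = f ` (S - vs F)" if "S \<subseteq> V" "F \<in> Field r" for F S
    using inj_on_image_set_diff[OF inj, of S "vs F"] that
      face_vertices_automorphism[OF assms(1) that(2)] by (auto simp: face_vertices_def)
  have sub: "f ` S \<subseteq> V - vs (f F)" if "S \<subseteq> V - vs F" "F \<in> Field r" for F S
  proof -
    have "f ` S \<subseteq> V"
      using that automorphism_vertex[OF assms(1)] by blast
    moreover have "f ` S - vs (f F) = f ` S"
    proof -
      have "S - vs F = S" "S \<subseteq> V"
        using that(1) by auto
      then show ?thesis
        using diff[of S F] that(2) by simp
    qed
    ultimately show ?thesis
      by blast
  qed
  show ?thesis
    using assms(2)
  proof (cases rule: in_power_complex_cases)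
    case (2 F S)
    then show ?thesis
      using sub automorphism_Field[OF assms(1)] by simp
  next
    case (3 F G S)
    have "F \<in> Field r" "G \<in> Field r" "S \<subseteq> V"
      using 3 by (auto intro: FieldI1 FieldI2)
    then show ?thesis
      using 3 sub[OF 3(4)] diff automorphism_mono[OF assms(1) 3(3)] by simp
  qed simp
qed

lemma automorphism_power_lift:
  assumes "automorphism r f"
  shows "automorphism P (power_lift f)"
proof -
  obtain f' where f': "automorphism r f'" "\<And>x. x \<in> Field r \<Longrightarrow> f' (f x) = x"
    "\<And>x. x \<in> Field r \<Longrightarrow> f (f' x) = x"
    using automorphism_inverse[OF assms(1)] by metis
  have inv: "power_lift g (power_lift h x) = x"
    if "x \<in> Field P" "\<And>x. x \<in> Field r \<Longrightarrow> g (h x) = x" for x g h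
    using that(1)
  proof (cases rule: Field_power_cases)
    case (2 F S)
    then have "S \<subseteq> Field r"
      by (auto simp: faces_def)
    then have "g ` h ` S = S"
      using that(2) by (force simp: image_image)
    then show ?thesis
      using 2 that(2) by simp
  qed simp
  show ?thesis
    using power_lift_mono[OF assms] power_lift_mono[OF f'(1)] inv f'(2,3)
    by (intro automorphismI[of _ _ "power_lift f'"]) blast+
qed

section \<open>Vertex-transitivity, vertex-figures and heredity of the power complex\<close>

lemma vertex_transitive_power: "vertex_transitive P (power_rank rk)"
  unfolding vertex_transitive_def faces_0_power
proof (intro ballI)
  fix u v assume "u \<in> {Some (bot, S) |S. S \<subseteq> V}" "v \<in> {Some (bot, S) |S. S \<subseteq> V}"
  then obtain S T where uv: "u = Some (bot, S)" "v = Some (bot, T)" "S \<subseteq> V" "T \<subseteq> V"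
    by blast
  then have "translation (sym_diff S T) u = v"
    by (auto simp: face_vertices_bot)
  moreover have "sym_diff S T \<subseteq> V"
    using uv by auto
  ultimately show "\<exists>f. automorphism P f \<and> f u = v"
    using automorphism_translation by blast
qed

text \<open>A cube contains the zero vector exactly when its fixed coordinates are all 0, so only
  its first component carries information. \<open>None\<close> is not in this section, so
  \<open>the\<close> is harmless.\<close>

lemma vertex_figure_power:
  "order_isomorphism (vertex_figure P (Some (bot, {}))) r (fst \<circ> the) (\<lambda>F. Some (F, {}))"
proof -
  have iff: "(x, y) \<in> vertex_figure P (Some (bot, {})) \<longleftrightarrow>
      (\<exists>F G. x = Some (F, {}) \<and> y = Some (G, {}) \<and> (F, G) \<in> r)" for x y
  proof
    assume "(x, y) \<in> vertex_figure P (Some (bot, {}))"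
    then have "(x, y) \<in> P" "(Some (bot, {}), x) \<in> P"
      by (simp_all add: vertex_figure_def face_section_iff)
    then show "\<exists>F G. x = Some (F, {}) \<and> y = Some (G, {}) \<and> (F, G) \<in> r"
      by (auto elim!: in_power_complex_cases)
  next
    assume "\<exists>F G. x = Some (F, {}) \<and> y = Some (G, {}) \<and> (F, G) \<in> r"
    then obtain F G where "x = Some (F, {})" "y = Some (G, {})" "(F, G) \<in> r"
      by blast
    moreover from this have "F \<in> Field r" "G \<in> Field r"
      by (auto intro: FieldI1 FieldI2)
    ultimately show "(x, y) \<in> vertex_figure P (Some (bot, {}))"
      using bot_le le_top by (simp add: vertex_figure_def face_section_iff greatest_face_power)
  qed
  show ?thesis
    by unfold_locales (auto simp: iff Field_def)
qed

lemma face_hereditary_power: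
  assumes hered: "face_hereditary j r rk"
  shows "face_hereditary (j + 1) P (power_rank rk)"
  unfolding face_hereditary_def least_face_power
proof (intro ballI allI impI)
  interpret Q: finite_abstract_polytope "m + 1" P "power_rank rk"
    using abstract_polytope_power finite_Field_power
    by (simp add: finite_abstract_polytope_def finite_abstract_polytope_axioms_def)
  fix X g
  assume X: "X \<in> faces (int (j + 1)) P (power_rank rk)"
  let ?Sec = "face_section P None X"
  assume g: "automorphism ?Sec g"
  have "X \<in> Field P" "power_rank rk X = int j + 1"
    using X by (auto simp: faces_def)
  then obtain F S where FS: "X = Some (F, S)" "F \<in> Field r" "S \<subseteq> V - vs F" and "rk F = int j"
    by (cases rule: Field_power_cases) auto
  then have F: "F \<in> faces (int j) r rk"
    by (simp add: faces_def)
  have SV: "S \<subseteq> V"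
    using FS by blast
  have S_diff: "S - vs H = S" if "(H, F) \<in> r" for H
    using FS(3) face_vertices_mono[OF that] by auto
  have Sec_iff: "(x, y) \<in> ?Sec \<longleftrightarrow> (x, y) \<in> P \<and> (y, X) \<in> P" for x y
    using Q.trans None_power_le FieldI1 by (metis face_section_iff FieldI2)
  have Field_Sec: "Field ?Sec = {x. (x, X) \<in> P}"
    using Field_face_section[OF Partial_order_power] None_power_le FieldI1 by fastforce
  \<comment> \<open>The vertex of \<open>X\<close> whose free coordinates are all 0. As
    \<open>S\<close> avoids \<open>vs F\<close>, the faces between \<open>?o\<close> and
    \<open>X\<close> are exactly the \<open>Some (H, S)\<close> with \<open>H\<close> below
    \<open>F\<close>.\<close>
  let ?o = "Some (bot, S)"
  have "(?o, X) \<in> P"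
    unfolding FS(1) using FS(2) bot_le S_diff[OF refl] face_vertices_bot SV by simp
  then have o_Sec: "?o \<in> Field ?Sec"
    unfolding Field_Sec by simp
  have None_Sec: "None \<in> Field ?Sec"
    unfolding Field_Sec using \<open>X \<in> Field P\<close> None_power_le by simp
  have below_o: "x = None \<or> x = ?o" if "(x, ?o) \<in> P" for x
    using that by (cases x) (auto simp: le_bot_iff face_vertices_bot)
  obtain g' where g': "automorphism ?Sec g'" "\<And>x. x \<in> Field ?Sec \<Longrightarrow> g' (g x) = x"
    "\<And>x. x \<in> Field ?Sec \<Longrightarrow> g (g' x) = x"
    using automorphism_inverse[OF g] by metis
  have g_None: "k None = None" if k: "automorphism ?Sec k" for k
  proof -
    obtain k' where k': "automorphism ?Sec k'" "\<And>x. x \<in> Field ?Sec \<Longrightarrow> k (k' x) = x"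
      using automorphism_inverse[OF k] by metis
    have "(k' None, X) \<in> P"
      using automorphism_Field[OF k'(1) None_Sec] by (simp add: Field_Sec)
    then have "(None, k' None) \<in> ?Sec"
      using None_power_le FieldI1 by (simp add: Sec_iff FieldI1)
    then have "(k None, k (k' None)) \<in> ?Sec"
      by (rule automorphism_mono[OF k])
    then have "(k None, None) \<in> P"
      using k'(2)[OF None_Sec] by (simp add: Sec_iff)
    then show ?thesis
      by (cases "k None") auto
  qed
  \<comment> \<open>The section has not been shown to be a polytope, so that \<open>g\<close> maps
    vertices to vertices is proved directly: a vertex \<open>?w\<close> below \<open>g ?o\<close>
    pulls back to a face other than \<open>None\<close> below \<open>?o\<close>, hence to
    \<open>?o\<close>.\<close>
  obtain T where T: "g ?o = Some (bot, T)" "T \<subseteq> V" "T - vs F = S"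
  proof -
    have "g ?o \<noteq> None"
      using g_None[OF g] automorphism_eq_iff[OF g o_Sec None_Sec] by auto
    then obtain H T where HT: "g ?o = Some (H, T)"
      by (cases "g ?o") auto
    have "(g ?o, X) \<in> P"
      using automorphism_Field[OF g o_Sec] by (simp add: Field_Sec)
    then have le: "(H, F) \<in> r" "T \<subseteq> V - vs H" "T - vs F = S"
      using HT FS by auto
    let ?w = "Some (bot, T)"
    have "H \<in> Field r"
      using le by (auto intro: FieldI1)
    then have w: "(?w, g ?o) \<in> ?Sec"
      unfolding Sec_iff HT unfolding FS(1) using le bot_le face_vertices_bot by auto
    then have w_Sec: "?w \<in> Field ?Sec"
      by (rule FieldI1)
    have "(g' ?w, ?o) \<in> P"
      using automorphism_mono[OF g'(1) w] g'(2)[OF o_Sec] by (simp add: Sec_iff)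
    moreover have "g' ?w \<noteq> None"
      using g'(3)[OF w_Sec] g_None[OF g] by (metis option.distinct(1))
    ultimately have "g' ?w = ?o"
      using below_o by metis
    then have "g ?o = ?w"
      using g'(3)[OF w_Sec] by simp
    then show ?thesis
      using le by (intro that) auto
  qed
  \<comment> \<open>\<open>S\<close> and \<open>T\<close> agree outside \<open>vs F\<close>, and
    \<open>S\<close> is empty inside, so \<open>T \<inter> vs F\<close> is their difference.
    Translating by it returns \<open>g ?o\<close> to \<open>?o\<close> and fixes \<open>X\<close>,
    whose free coordinates are those in \<open>vs F\<close>.\<close>
  define t where "t = translation (T \<inter> vs F)"
  have t: "automorphism P t"
    unfolding t_def using T(2) by (intro automorphism_translation) auto
  have tX: "t X = X"
    using FS by (auto simp: t_def)
  have t_Sec: "automorphism ?Sec t"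
    using t tX \<open>X \<in> Field P\<close> by (intro automorphism_face_section) (auto simp: t_def)
  define g1 where "g1 = t \<circ> g"
  have g1: "automorphism ?Sec g1"
    unfolding g1_def using t_Sec g by (rule automorphism_comp)
  have "sym_diff T (T \<inter> vs F) = S"
    using T(3) by auto
  then have g1_o: "g1 ?o = ?o"
    by (simp add: g1_def T(1) t_def face_vertices_bot)
  obtain g1' where g1': "automorphism ?Sec g1'" "\<And>x. x \<in> Field ?Sec \<Longrightarrow> g1' (g1 x) = x"
    "\<And>x. x \<in> Field ?Sec \<Longrightarrow> g1 (g1' x) = x"
    using automorphism_inverse[OF g1] by metis
  have g1'_o: "g1' ?o = ?o"
    using g1'(2)[OF o_Sec] g1_o by simp
  have HS_Sec: "(?o, Some (H, S)) \<in> ?Sec" if "(H, F) \<in> r" for H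
    unfolding Sec_iff unfolding FS(1)
    using that S_diff[OF that] S_diff[OF refl[OF FS(2)]] bot_le FieldI1[OF that] SV face_vertices_bot
    by auto
  \<comment> \<open>The action of \<open>k\<close> on the faces above \<open>?o\<close>, read in
    \<open>K\<close>. It is kept general in \<open>k\<close> so that the map for the inverse
    \<open>g1'\<close> inverts the one for \<open>g1\<close>.\<close>
  define \<phi> where "\<phi> k H = fst (the (k (Some (H, S))))"
    for k :: "('a \<times> 'a set) option \<Rightarrow> ('a \<times> 'a set) option" and H
  have \<phi>: "k (Some (H, S)) = Some (\<phi> k H, S) \<and> (\<phi> k H, F) \<in> r"
    if k: "automorphism ?Sec k" "k ?o = ?o" and H: "(H, F) \<in> r" for k H
  proof -
    have "(?o, k (Some (H, S))) \<in> ?Sec"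
      using automorphism_mono[OF k(1) HS_Sec[OF H]] k(2) by simp
    then obtain E where E: "k (Some (H, S)) = Some (E, S - vs E)" "(Some (E, S - vs E), X) \<in> P"
      by (auto simp: Sec_iff elim!: in_power_complex_cases)
    then have "(E, F) \<in> r"
      using FS by simp
    then show ?thesis
      using E S_diff by (simp add: \<phi>_def)
  qed
  let ?L = "face_section r bot F"
  have L_iff: "(x, y) \<in> ?L \<longleftrightarrow> (x, y) \<in> r \<and> (y, F) \<in> r" for x y
    using trans bot_le FieldI1 by (metis face_section_iff FieldI2)
  have Field_L: "Field ?L = {x. (x, F) \<in> r}"
    using Field_face_section[OF partial_order] bot_le FieldI1 by fastforce
  have \<phi>_mono: "(\<phi> k x, \<phi> k y) \<in> ?L"
    if k: "automorphism ?Sec k" "k ?o = ?o" and xy: "(x, y) \<in> ?L" for k x y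
  proof -
    have le: "(x, F) \<in> r" "(y, F) \<in> r" "(x, y) \<in> r"
      using xy trans by (auto simp: L_iff)
    then have "S \<subseteq> V - vs x"
      using S_diff[of x] SV by auto
    then have "(Some (x, S), Some (y, S)) \<in> ?Sec"
      using le S_diff HS_Sec[of y] by (auto simp: Sec_iff)
    then have "(Some (\<phi> k x, S), Some (\<phi> k y, S)) \<in> ?Sec"
      using automorphism_mono[OF k(1)] \<phi>[OF k le(1)] \<phi>[OF k le(2)] by metis
    then show ?thesis
      using \<phi>[OF k le(2)] by (simp add: L_iff Sec_iff)
  qed
  have "automorphism ?L (\<phi> g1)"
  proof (rule automorphismI[of _ _ "\<phi> g1'"])
    show "(\<phi> g1 x, \<phi> g1 y) \<in> ?L" "(\<phi> g1' x, \<phi> g1' y) \<in> ?L" if "(x, y) \<in> ?L" for x y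
      using \<phi>_mono[OF g1 g1_o that] \<phi>_mono[OF g1'(1) g1'_o that] .
    fix x assume "x \<in> Field ?L"
    then have x: "(x, F) \<in> r" "Some (x, S) \<in> Field ?Sec"
      using HS_Sec by (auto simp: Field_L intro: FieldI2)
    show "\<phi> g1' (\<phi> g1 x) = x"
      using \<phi>[OF g1 g1_o x(1)] g1'(2)[OF x(2)] by (simp add: \<phi>_def[of g1'])
    show "\<phi> g1 (\<phi> g1' x) = x"
      using \<phi>[OF g1'(1) g1'_o x(1)] g1'(3)[OF x(2)] by (simp add: \<phi>_def[of g1])
  qed
  then obtain \<psi> where \<psi>: "automorphism r \<psi>" "\<And>x. (x, F) \<in> r \<Longrightarrow> \<psi> x = \<phi> g1 x"
    using hered F unfolding face_hereditary_def by (metis Field_L mem_Collect_eq)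
  \<comment> \<open>\<open>power_lift \<psi>\<close> fixes the zero vector but may move
    \<open>S\<close>, as \<open>\<psi>\<close> is controlled only below \<open>F\<close>.
    Conjugating by the translation, its own inverse, makes \<open>?o\<close> the fixed
    vertex.\<close>
  define k where "k = translation S \<circ> power_lift \<psi> \<circ> translation S"
  have k: "automorphism P k"
    unfolding k_def using automorphism_translation[OF SV] automorphism_power_lift[OF \<psi>(1)]
    by (intro automorphism_comp)
  have k_eq: "k (Some (H, S)) = g1 (Some (H, S))" if "(H, F) \<in> r" for H
    using \<phi>[OF g1 g1_o that] S_diff \<psi>(2)[OF that] by (simp add: k_def)
  obtain k' where k': "automorphism P k'" "\<And>x. x \<in> Field P \<Longrightarrow> k' (k x) = x"
    "\<And>x. x \<in> Field P \<Longrightarrow> k (k' x) = x"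
    using automorphism_inverse[OF k] by metis
  obtain \<Phi> where \<Phi>: "\<Phi> \<in> flags r" "F \<in> \<Phi>"
    using flag_through FS(2) .
  have g1_P: "g1 x \<in> Field P" if "(x, X) \<in> P" for x
    using automorphism_Field[OF g1, of x] that by (auto simp: Field_Sec intro: FieldI1)
  \<comment> \<open>The part of \<open>power_flag S \<Phi>\<close> below \<open>X\<close> consists
    of \<open>None\<close> and faces \<open>Some (H, S)\<close> with \<open>H\<close> below
    \<open>F\<close>, precisely where \<open>k\<close> and \<open>g1\<close> are known to
    agree.\<close>
  have "(k' \<circ> g1) y = y" if y: "(y, X) \<in> P" for y
  proof (rule Q.rigidity[of X _ "power_flag S \<Phi>" y])
    show "((k' \<circ> g1) x, (k' \<circ> g1) y) \<in> P" if "(x, y) \<in> P" "(y, X) \<in> P" for x y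
      using that automorphism_mono[OF g1, of x y] automorphism_mono[OF k'(1)] by (simp add: Sec_iff)
    show "inj_on (k' \<circ> g1) {x. (x, X) \<in> P}"
      using automorphism_eq_iff[OF k'(1)] g1_P automorphism_eq_iff[OF g1]
      by (auto simp: inj_on_def Field_Sec)
    show "power_flag S \<Phi> \<in> flags P"
      using power_flag_in_flags[OF SV \<Phi>(1)] .
    show "X \<in> power_flag S \<Phi>"
      using FS \<Phi>(2) S_diff[of F] refl by (auto simp: power_flag_def)
    fix x assume "x \<in> power_flag S \<Phi>" "(x, X) \<in> P"
    then consider "x = None" | H where "x = Some (H, S)" "(H, F) \<in> r"
      using FS S_diff by (auto simp: power_flag_def)
    then show "(k' \<circ> g1) x = x"
    proof cases
      case 1
      then show ?thesis
        using g_None[OF g1] k'(2)[of None] by (simp add: k_def)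
    next
      case 2
      then show ?thesis
        using k_eq[OF 2(2)] k'(2)[OF FieldI1[OF \<open>(x, X) \<in> P\<close>]] by simp
    qed
  qed (use \<open>X \<in> Field P\<close> y in auto)
  then have g1_k: "g1 y = k y" if "(y, X) \<in> P" for y
    using that k'(3)[OF g1_P[OF that]] by simp
  \<comment> \<open>\<open>t\<close> is an involution, so applying it once more to
    \<open>t \<circ> g\<close>, which \<open>k\<close> extends, gives back \<open>g\<close>.\<close>
  have "(t \<circ> k) y = g y" if "y \<in> Field ?Sec" for y
  proof -
    have "(y, X) \<in> P" "(g y, X) \<in> P"
      using that automorphism_Field[OF g that] by (simp_all add: Field_Sec)
    then have "t (g y) = k y"
      using g1_k[of y] by (simp add: g1_def)
    moreover have "t (t (g y)) = g y"
      unfolding t_def using FieldI1[OF \<open>(g y, X) \<in> P\<close>] by (rule translation_translation)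
    ultimately show ?thesis
      by simp
  qed
  then show "\<exists>f. automorphism P f \<and> (\<forall>x\<in>Field ?Sec. f x = g x)"
    using automorphism_comp[OF t k] by blast
qed

end

theorem theorem6:
  fixes n j :: nat and K :: "'a rel" and rk :: "'a \<Rightarrow> int"
  assumes "n \<ge> 2"
    and "j \<in> {1..n - 1}"
    and "abstract_polytope n K rk"
    and "finite (Field K)"
    and "vertex_describable K rk"
    and "face_hereditary j K rk"
  shows "\<exists>(P :: nat rel) (rk' :: nat \<Rightarrow> int).
           abstract_polytope (n + 1) P rk' \<and>
           finite (Field P) \<and>
           vertex_transitive P rk' \<and>
           face_hereditary (j + 1) P rk' \<and>
           (\<exists>u\<in>faces 0 P rk'. \<exists>f. iso (vertex_figure P u) K f)"
proof -
  interpret K: finite_abstract_polytope n K rk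
    using assms(3,4) by (simp add: finite_abstract_polytope_def finite_abstract_polytope_axioms_def)
  let ?rk = "power_rank rk" and ?o = "Some (K.bot, {})"
  obtain P :: "nat rel" and e d where "order_isomorphism K.P P e d"
    using obtain_order_isomorphism_nat[OF K.finite_Field_power] .
  then interpret order_isomorphism K.P P e d .
  have P: "abstract_polytope (n + 1) P (?rk \<circ> d)"
    using abstract_polytope_transport[OF K.abstract_polytope_power] .
  have antisym: "antisym P" "antisym K.P"
    using abstract_polytope.partial_order[OF P] K.Partial_order_power by (simp_all add: order_on_defs)
  \<comment> \<open>A vertex-figure is a section whose upper end is the greatest face, so it is
    carried along once the greatest face is. Going back by \<open>d\<close> and projecting to first
    components gives the isomorphism onto \<open>K\<close>.\<close>
  have "order_isomorphism (vertex_figure K.P ?o) (vertex_figure P (e ?o)) e d"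
    unfolding vertex_figure_def K.greatest_face_power
      greatest_face_transport[OF K.is_greatest_power[THEN iffD2, OF HOL.refl] antisym(1)]
    using K.bot_in K.top_in by (intro section_isomorphism) simp_all
  then have "order_isomorphism (vertex_figure P (e ?o)) (vertex_figure K.P ?o) d e"
    by (rule order_isomorphism.inverse)
  then have "\<exists>f. iso (vertex_figure P (e ?o)) K f"
    using order_isomorphism.iso_e order_isomorphism_trans K.vertex_figure_power by blast
  moreover have "e ?o \<in> faces 0 P (?rk \<circ> d)"
    unfolding faces_transport K.faces_0_power by blast
  moreover have "finite (Field P)"
    using K.finite_Field_power by (simp add: image_e[symmetric])
  moreover have "face_hereditary (j + 1) P (?rk \<circ> d)"
    using face_hereditary_transport[OF K.face_hereditary_power[OF assms(6)] _ antisym(2,1)]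
      K.is_least_power by blast
  ultimately show ?thesis
    using P vertex_transitive_transport[OF K.vertex_transitive_power] by blast
qed

end
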